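(* Let $\Gamma$ be a finite oriented simplicial complex on $n$ vertices, $k>0$, $\ell\ge1$, and $\epsilon,\eta>0$. Run the following procedure (CBNE-Var), where $C=2$ if $\Gamma$ is a clique complex and $C=n$ otherwise: set $N_s=C^{4\ell/3}\epsilon^{-4/3}\eta^{-2/3}$; sample $k$-simplices $\sigma_1,\dots,\sigma_{N_s}$ i.i.d. uniformly from $S_k$ and set $\hat V=\frac1{N_s}\sum_{i=1}^{N_s}\|H|\sigma_i\rangle\|_1^{2\ell}$; set $N_p=\frac{1}{\eta\epsilon^2}\big(\hat V+\frac{C^{2\ell}}{\sqrt{N_s}}\big)$; sample $N_p$ independent random paths $\overline\sigma_1,\dots,\overline\sigma_{N_p}$ distributed as $\overline{\boldsymbol\sigma}$; output $\hat\mu=\frac1{N_p}\sum_{i=1}^{N_p}f_k(\overline\sigma_i)$. Then $\hat\mu$ is an $(\epsilon,\eta)$-estimate of $\frac{1}{|S_k|}\mathrm{tr}(H^\ell)$, and the total number of samples $N_s+N_p$ is at most $$\frac{3n^{4\ell/3}}{\eta^{2/3}\epsilon^{4/3}}+\frac{1}{\eta\epsilon^2}\cdot\frac{1}{|S_k|}\sum_{\sigma\in S_k}\|H|\sigma\rangle\|_1^{2\ell}$$ for a general simplicial complex, and at most $$\frac{3\cdot 2^{4\ell/3}}{\eta^{2/3}\epsilon^{4/3}}+\frac{1}{\eta\epsilon^2}\cdot\frac{1}{|S_k|}\sum_{\sigma\in S_k}\|H|\sigma\rangle\|_1^{2\ell}$$ for a clique complex.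
   Context: A simplicial complex $\Gamma$ on $\{x_1,\dots,x_n\}$ is a family of subsets closed under subsets, oriented via $x_1<\dots<x_n$; $S_k$ is the set of its $k$-simplices (elements of size $k+1$). A clique complex of a graph has as simplices the vertex sets of complete subgraphs. The boundary map $\partial_k|\{x_{i_0},\dots,x_{i_k}\}\rangle=\sum_{j=0}^k(-1)^{j+1}|\{x_{i_0},\dots,x_{i_k}\}\setminus\{x_{i_j}\}\rangle$ ($i_0<\dots<i_k$); $\Delta_k$ is the matrix of $\partial_k^\dagger\partial_k+\partial_{k+1}\partial_{k+1}^\dagger$ on basis $\{|\sigma\rangle:\sigma\in S_k\}$, $H=I-\frac1n\Delta_k$, $\|H|\sigma\rangle\|_1=\sum_\tau|H_{\tau\sigma}|$. Markov chain $P_{\sigma\tau}=|\langle\tau|H|\sigma\rangle|/\|H|\sigma\rangle\|_1$ on $S_k$; the random path $\overline{\boldsymbol\sigma}=(\sigma_0,\dots,\sigma_\ell)$ has $\sigma_0$ uniform on $S_k$ and then follows $P$. $f_k(\sigma_0,\dots,\sigma_\ell)=[\sigma_\ell=\sigma_0]\prod_{i=0}^{\ell-1}(-1)^{s(\sigma_i,\sigma_{i+1})}\|H|\sigma_i\rangle\|_1$, where $(-1)^{s(\sigma_i,\sigma_{i+1})}$ is the sign of $\langle\sigma_i|H|\sigma_{i+1}\rangle$. A random variable $X$ is an $(\epsilon,\eta)$-estimate of $\mu$ if $\Pr[|X-\mu|>\epsilon]<\eta$.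
   Formalization: N_p is random and the bound on N_s+N_p can fail with positive probability for small ε; it is proved in expectation (also for counts rounded up, if N_s≥2) and with probability at least 3/4; S_k is assumed nonempty, and the chain stays at σ when H|σ⟩=0. *)

theory Defs
  imports "HOL-Probability.Probability"
begin

text \<open>The vertex \<open>x\<^sub>i\<close> is represented by the natural number \<open>i\<close>, so that the orientation
  \<open>x\<^sub>1 < \<dots> < x\<^sub>n\<close> is the usual order.\<close>

definition is_simplicial_complex :: "nat \<Rightarrow> nat set set \<Rightarrow> bool" where
  "is_simplicial_complex n \<Gamma> \<longleftrightarrow> \<Gamma> \<subseteq> Pow {1..n} \<and> (\<forall>\<sigma>\<in>\<Gamma>. \<forall>\<tau>. \<tau> \<subseteq> \<sigma> \<longrightarrow> \<tau> \<in> \<Gamma>)"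

definition is_clique_complex :: "nat \<Rightarrow> nat set set \<Rightarrow> bool" where
  "is_clique_complex n \<Gamma> \<longleftrightarrow>
     (\<exists>E. E \<subseteq> {e. e \<subseteq> {1..n} \<and> card e = 2} \<and>
          \<Gamma> = {\<sigma>. \<sigma> \<subseteq> {1..n} \<and> (\<forall>x\<in>\<sigma>. \<forall>y\<in>\<sigma>. x \<noteq> y \<longrightarrow> {x, y} \<in> E)})"

definition simplices :: "nat set set \<Rightarrow> nat \<Rightarrow> nat set set" where
  "simplices \<Gamma> k = {\<sigma>\<in>\<Gamma>. card \<sigma> = k + 1}"

text \<open>Operators are real matrices indexed directly by simplices, row index first:
  \<open>A \<tau> \<sigma>\<close> is \<open>\<langle>\<tau>|A|\<sigma>\<rangle>\<close>. All entries are real, so the adjoint is the transpose.\<close>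

definition boundary :: "nat \<Rightarrow> nat set \<Rightarrow> nat set \<Rightarrow> real" where
  "boundary k \<rho> \<sigma> =
     (\<Sum>j\<le>k. if \<rho> = \<sigma> - {sorted_list_of_set \<sigma> ! j} then (-1) ^ (j + 1) else 0)"

definition laplacian :: "nat set set \<Rightarrow> nat \<Rightarrow> nat set \<Rightarrow> nat set \<Rightarrow> real" where
  "laplacian \<Gamma> k \<tau> \<sigma> =
     (\<Sum>\<rho>\<in>simplices \<Gamma> (k - 1). boundary k \<rho> \<tau> * boundary k \<rho> \<sigma>) +
     (\<Sum>\<rho>\<in>simplices \<Gamma> (k + 1). boundary (k + 1) \<tau> \<rho> * boundary (k + 1) \<sigma> \<rho>)"

definition Hmat :: "nat \<Rightarrow> nat set set \<Rightarrow> nat \<Rightarrow> nat set \<Rightarrow> nat set \<Rightarrow> real" where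
  "Hmat n \<Gamma> k \<tau> \<sigma> = (if \<tau> = \<sigma> then 1 else 0) - laplacian \<Gamma> k \<tau> \<sigma> / real n"

definition Hnorm :: "nat \<Rightarrow> nat set set \<Rightarrow> nat \<Rightarrow> nat set \<Rightarrow> real" where
  "Hnorm n \<Gamma> k \<sigma> = (\<Sum>\<tau>\<in>simplices \<Gamma> k. \<bar>Hmat n \<Gamma> k \<tau> \<sigma>\<bar>)"

primrec mat_power :: "'a set \<Rightarrow> ('a \<Rightarrow> 'a \<Rightarrow> real) \<Rightarrow> nat \<Rightarrow> 'a \<Rightarrow> 'a \<Rightarrow> real" where
  "mat_power S A 0 = (\<lambda>\<tau> \<sigma>. if \<tau> = \<sigma> then 1 else 0)"
| "mat_power S A (Suc l) = (\<lambda>\<tau> \<sigma>. \<Sum>\<rho>\<in>S. A \<tau> \<rho> * mat_power S A l \<rho> \<sigma>)"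

definition mat_trace :: "'a set \<Rightarrow> ('a \<Rightarrow> 'a \<Rightarrow> real) \<Rightarrow> real" where
  "mat_trace S A = (\<Sum>\<sigma>\<in>S. A \<sigma> \<sigma>)"

text \<open>The formula for \<open>P\<^sub>\<sigma>\<^sub>\<tau>\<close> is \<open>0/0\<close> if \<open>H|\<sigma>\<rangle> = 0\<close>; the chain then stays at \<open>\<sigma>\<close>.
  The choice is immaterial: the estimator \<open>path_value\<close> below vanishes on every path of length
  at least 1 that visits such a \<open>\<sigma>\<close>.\<close>

definition transition :: "nat \<Rightarrow> nat set set \<Rightarrow> nat \<Rightarrow> nat set \<Rightarrow> nat set pmf" where
  "transition n \<Gamma> k \<sigma> =
     (if Hnorm n \<Gamma> k \<sigma> = 0 then return_pmf \<sigma>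
      else embed_pmf (\<lambda>\<tau>. if \<tau> \<in> simplices \<Gamma> k
                           then \<bar>Hmat n \<Gamma> k \<tau> \<sigma>\<bar> / Hnorm n \<Gamma> k \<sigma> else 0))"

lemma finite_simplices:
  assumes "is_simplicial_complex n \<Gamma>"
  shows "finite (simplices \<Gamma> k)"
proof (rule finite_subset)
  show "simplices \<Gamma> k \<subseteq> Pow {1..n}"
    using assms by (auto simp: simplices_def is_simplicial_complex_def)
qed simp

lemma pmf_transition:
  assumes "is_simplicial_complex n \<Gamma>" and nz: "Hnorm n \<Gamma> k \<sigma> \<noteq> 0"
  shows "pmf (transition n \<Gamma> k \<sigma>) \<tau> =
    (if \<tau> \<in> simplices \<Gamma> k then \<bar>Hmat n \<Gamma> k \<tau> \<sigma>\<bar> / Hnorm n \<Gamma> k \<sigma> else 0)"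
proof -
  let ?S = "simplices \<Gamma> k"
  let ?f = "\<lambda>\<tau>. if \<tau> \<in> ?S then \<bar>Hmat n \<Gamma> k \<tau> \<sigma>\<bar> / Hnorm n \<Gamma> k \<sigma> else 0"
  have fin: "finite ?S" using assms(1) by (rule finite_simplices)
  have pos: "Hnorm n \<Gamma> k \<sigma> \<ge> 0" by (simp add: Hnorm_def sum_nonneg)
  have nonneg: "?f \<tau> \<ge> 0" for \<tau> using pos by simp
  have "(\<integral>\<^sup>+\<tau>. ennreal (?f \<tau>) \<partial>count_space UNIV) = (\<Sum>\<tau>\<in>?S. ennreal (?f \<tau>))"
    by (rule nn_integral_count_space'[OF fin]) auto
  also have "\<dots> = ennreal (\<Sum>\<tau>\<in>?S. ?f \<tau>)" by (intro sum_ennreal nonneg)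
  also have "(\<Sum>\<tau>\<in>?S. ?f \<tau>) = 1"
    using nz by (simp add: sum_divide_distrib[symmetric] Hnorm_def)
  finally show ?thesis
    using nz nonneg by (simp add: transition_def pmf_embed_pmf)
qed

primrec path_from :: "nat \<Rightarrow> nat set set \<Rightarrow> nat \<Rightarrow> nat \<Rightarrow> nat set \<Rightarrow> nat set list pmf" where
  "path_from n \<Gamma> k 0 = (\<lambda>\<sigma>. return_pmf [\<sigma>])"
| "path_from n \<Gamma> k (Suc l) =
     (\<lambda>\<sigma>. bind_pmf (transition n \<Gamma> k \<sigma>) (\<lambda>\<tau>. map_pmf (\<lambda>p. \<sigma> # p) (path_from n \<Gamma> k l \<tau>)))"

definition random_path :: "nat \<Rightarrow> nat set set \<Rightarrow> nat \<Rightarrow> nat \<Rightarrow> nat set list pmf" where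
  "random_path n \<Gamma> k l = bind_pmf (pmf_of_set (simplices \<Gamma> k)) (path_from n \<Gamma> k l)"

definition path_value :: "nat \<Rightarrow> nat set set \<Rightarrow> nat \<Rightarrow> nat \<Rightarrow> nat set list \<Rightarrow> real" where
  "path_value n \<Gamma> k l p =
     (if p ! l = p ! 0 then 1 else 0) *
     (\<Prod>i<l. sgn (Hmat n \<Gamma> k (p ! i) (p ! Suc i)) * Hnorm n \<Gamma> k (p ! i))"

definition is_estimate :: "real pmf \<Rightarrow> real \<Rightarrow> real \<Rightarrow> real \<Rightarrow> bool" where
  "is_estimate X \<epsilon> \<eta> \<mu> \<longleftrightarrow> measure_pmf.prob X {x. \<bar>x - \<mu>\<bar> > \<epsilon>} < \<eta>"

text \<open>The average of \<open>g\<close> over \<open>N\<close> independent samples of \<open>X\<close>.\<close>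

definition sample_mean :: "nat \<Rightarrow> 'a pmf \<Rightarrow> ('a \<Rightarrow> real) \<Rightarrow> real pmf" where
  "sample_mean N X g =
     map_pmf (\<lambda>\<omega>. (\<Sum>i<N. g (\<omega> i)) / real N) (Pi_pmf {..<N} undefined (\<lambda>_. X))"

definition Cconst :: "nat \<Rightarrow> nat set set \<Rightarrow> real" where
  "Cconst n \<Gamma> = (if is_clique_complex n \<Gamma> then 2 else real n)"

text \<open>\<open>N_s\<close> and \<open>N_p\<close> are real numbers; they are rounded up where they are used as the number of
  samples to draw. \<open>N_p\<close> depends on the random value \<open>V\<close> of the variance estimator.\<close>

definition N_s :: "nat \<Rightarrow> nat set set \<Rightarrow> nat \<Rightarrow> real \<Rightarrow> real \<Rightarrow> real" where
  "N_s n \<Gamma> l \<epsilon> \<eta> =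
     Cconst n \<Gamma> powr (4 * real l / 3) * \<epsilon> powr (- 4 / 3) * \<eta> powr (- 2 / 3)"

definition N_p :: "nat \<Rightarrow> nat set set \<Rightarrow> nat \<Rightarrow> real \<Rightarrow> real \<Rightarrow> real \<Rightarrow> real" where
  "N_p n \<Gamma> l \<epsilon> \<eta> V =
     1 / (\<eta> * \<epsilon>\<^sup>2) * (V + Cconst n \<Gamma> ^ (2 * l) / sqrt (N_s n \<Gamma> l \<epsilon> \<eta>))"

definition V_hat :: "nat \<Rightarrow> nat set set \<Rightarrow> nat \<Rightarrow> nat \<Rightarrow> real \<Rightarrow> real \<Rightarrow> real pmf" where
  "V_hat n \<Gamma> k l \<epsilon> \<eta> =
     sample_mean (nat \<lceil>N_s n \<Gamma> l \<epsilon> \<eta>\<rceil>) (pmf_of_set (simplices \<Gamma> k)) (\<lambda>\<sigma>. Hnorm n \<Gamma> k \<sigma> ^ (2 * l))"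

text \<open>Joint distribution of the output of the procedure and of \<open>N_p\<close>.\<close>

definition CBNE_Var :: "nat \<Rightarrow> nat set set \<Rightarrow> nat \<Rightarrow> nat \<Rightarrow> real \<Rightarrow> real \<Rightarrow> (real \<times> real) pmf" where
  "CBNE_Var n \<Gamma> k l \<epsilon> \<eta> =
     bind_pmf (V_hat n \<Gamma> k l \<epsilon> \<eta>) (\<lambda>V.
       map_pmf (\<lambda>m. (m, N_p n \<Gamma> l \<epsilon> \<eta> V))
         (sample_mean (nat \<lceil>N_p n \<Gamma> l \<epsilon> \<eta> V\<rceil>) (random_path n \<Gamma> k l) (path_value n \<Gamma> k l)))"

text \<open>\<open>N_p\<close> is random, and for small \<open>\<epsilon>\<close> it exceeds the bound with positive probability whenever
  the column norms of \<open>H\<close> are not all equal. The claim that the procedure uses at most \<open>B\<close>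
  samples is therefore read as a bound on the expected number of samples, together with a bound
  that holds with probability at least \<open>3/4\<close>. (The term
  \<open>C\<^sup>2\<^sup>l / sqrt N_s\<close> is of the order of the standard deviation of the variance estimator, which
  gives a constant probability but not \<open>1 - \<eta>\<close>.) The second clause is about the numbers after rounding; without a lower
  bound on \<open>N_s\<close> it fails for large \<open>\<epsilon>\<close>, where \<open>B < 2\<close> is possible but 2 samples are drawn.\<close>

definition uses_at_most_samples ::
    "nat \<Rightarrow> nat set set \<Rightarrow> nat \<Rightarrow> nat \<Rightarrow> real \<Rightarrow> real \<Rightarrow> real \<Rightarrow> bool" where
  "uses_at_most_samples n \<Gamma> k l \<epsilon> \<eta> B \<longleftrightarrow>
     measure_pmf.expectation (CBNE_Var n \<Gamma> k l \<epsilon> \<eta>) (\<lambda>(m, Np). N_s n \<Gamma> l \<epsilon> \<eta> + Np) \<le> B \<and>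
     (N_s n \<Gamma> l \<epsilon> \<eta> \<ge> 2 \<longrightarrow>
        measure_pmf.expectation (CBNE_Var n \<Gamma> k l \<epsilon> \<eta>)
          (\<lambda>(m, Np). of_int \<lceil>N_s n \<Gamma> l \<epsilon> \<eta>\<rceil> + of_int \<lceil>Np\<rceil>) \<le> B) \<and>
     measure_pmf.prob (CBNE_Var n \<Gamma> k l \<epsilon> \<eta>) {(m, Np). N_s n \<Gamma> l \<epsilon> \<eta> + Np \<le> B} \<ge> 3 / 4"

end

theory Submission
  imports Defs
begin

text \<open>
  The column norms of \<open>H\<close> are at most \<open>C\<close>: off the diagonal, the up and down parts of the Laplacian
  cancel unless \<open>\<tau>\<close> arises from \<open>\<sigma>\<close> by exchanging a vertex for some \<open>w\<close> with \<open>\<sigma> \<union> {w} \<notin> \<Gamma>\<close>, and these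
  exchanges can be counted.

  The estimator \<open>f\<close> is unbiased, and its second moment is at most \<open>v\<close>, the average of \<open>\<parallel>H|\<sigma>\<rangle>\<parallel>\<^sup>2\<^sup>l\<close>:
  by AM-GM along a closed path, \<open>f\<^sup>2\<close> is at most the mean over \<open>j < l\<close> of \<open>\<parallel>H|\<sigma>\<^sub>j\<rangle>\<parallel>\<^sup>2\<^sup>l\<close>, and for each \<open>j\<close>
  the total weight of the closed paths with \<open>\<sigma>\<^sub>j = \<rho>\<close> is a return probability, hence at most 1.

  Given the variance estimate \<open>V\<close>, Chebyshev's inequality bounds the failure probability by
  \<open>\<eta> v / (V + s)\<close> with \<open>s = C\<^sup>2\<^sup>l / sqrt N_s\<close>. Since \<open>V\<close> has mean \<open>v\<close> and variance at most \<open>v s\<^sup>2 / C\<^sup>2\<^sup>l\<close>, a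
  second-order expansion around \<open>v\<close> shows that \<open>v / (V + s)\<close> has expectation less than 1.
\<close>

section \<open>Sample means of finitely supported distributions\<close>

text \<open>The distributions of the procedure have finite support, so conditioning on the first
  stage is an identity between finite sums and integrability is automatic.\<close>

lemma expectation_bind_finite:
  fixes h :: "'b \<Rightarrow> real"
  assumes "finite (set_pmf p)" and "\<And>x. x \<in> set_pmf p \<Longrightarrow> finite (set_pmf (f x))"
  shows "measure_pmf.expectation (bind_pmf p f) h =
    measure_pmf.expectation p (\<lambda>x. measure_pmf.expectation (f x) h)"
  using assms
  by (simp add: pmf_expectation_bind[of "set_pmf p"] integral_measure_pmf[of "set_pmf p"])

lemma prob_bind_finite:
  assumes "finite (set_pmf p)" and "\<And>x. x \<in> set_pmf p \<Longrightarrow> finite (set_pmf (f x))"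
  shows "measure_pmf.prob (bind_pmf p f) A =
    measure_pmf.expectation p (\<lambda>x. measure_pmf.prob (f x) A)"
  using expectation_bind_finite[OF assms, where h = "indicat_real A"] by simp

lemma finite_set_Pi_pmf:
  assumes "finite A" and "finite (set_pmf X)"
  shows "finite (set_pmf (Pi_pmf A d (\<lambda>_. X)))"
  using assms by (simp add: set_Pi_pmf finite_PiE_dflt comp_def)

lemma expectation_sum_Pi_pmf:
  fixes g :: "'a \<Rightarrow> real"
  assumes "finite A" and "finite (set_pmf X)"
  shows "measure_pmf.expectation (Pi_pmf A d (\<lambda>_. X)) (\<lambda>\<omega>. \<Sum>i\<in>A. g (\<omega> i)) =
    real (card A) * measure_pmf.expectation X g"
proof -
  have "measure_pmf.expectation (Pi_pmf A d (\<lambda>_. X)) (\<lambda>\<omega>. g (\<omega> i)) = measure_pmf.expectation X g"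
    if "i \<in> A" for i
  proof -
    have "measure_pmf.expectation (Pi_pmf A d (\<lambda>_. X)) (\<lambda>\<omega>. g (\<omega> i)) =
      measure_pmf.expectation (map_pmf (\<lambda>\<omega>. \<omega> i) (Pi_pmf A d (\<lambda>_. X))) g"
      by simp
    also have "\<dots> = measure_pmf.expectation X g"
      using that assms(1) by (subst Pi_pmf_component) auto
    finally show ?thesis .
  qed
  then show ?thesis
    using assms by (subst Bochner_Integration.integral_sum)
      (auto intro!: integrable_measure_pmf_finite finite_set_Pi_pmf)
qed

text \<open>Additivity of the variance for independent centred variables. In the induction
  \<open>Pi_pmf_insert\<close> splits off one coordinate as an independent factor, and the cross
  term vanishes because the sum over the rest has mean zero.\<close>

lemma expectation_sum_squared_Pi_pmf:
  fixes g :: "'a \<Rightarrow> real"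
  assumes "finite A" and fin: "finite (set_pmf X)" and zero: "measure_pmf.expectation X g = 0"
  shows "measure_pmf.expectation (Pi_pmf A d (\<lambda>_. X)) (\<lambda>\<omega>. (\<Sum>i\<in>A. g (\<omega> i))\<^sup>2) =
    real (card A) * measure_pmf.expectation X (\<lambda>x. (g x)\<^sup>2)"
  using \<open>finite A\<close>
proof (induction rule: finite_induct)
  case empty
  show ?case by simp
next
  case (insert j A)
  let ?Q = "Pi_pmf A d (\<lambda>_. X)" and ?S = "\<lambda>\<omega>. \<Sum>i\<in>A. g (\<omega> i)"
  let ?T = "measure_pmf.expectation ?Q (\<lambda>\<omega>. (?S \<omega>)\<^sup>2)"
  have finQ: "finite (set_pmf ?Q)" using insert.hyps fin by (intro finite_set_Pi_pmf)
  note int = integrable_measure_pmf_finite[OF finQ] integrable_measure_pmf_finite[OF fin]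
  have S0: "measure_pmf.expectation ?Q ?S = 0"
    using expectation_sum_Pi_pmf[OF insert.hyps(1) fin, of d g] zero by simp
  have upd: "(\<Sum>i\<in>insert j A. g (fun_upd \<omega> j a i)) = g a + ?S \<omega>" for \<omega> a
    using insert.hyps by (auto intro!: sum.cong)
  have inner: "measure_pmf.expectation ?Q (\<lambda>\<omega>. (g a + ?S \<omega>)\<^sup>2) = (g a)\<^sup>2 + ?T" for a
  proof -
    have "measure_pmf.expectation ?Q (\<lambda>\<omega>. (g a + ?S \<omega>)\<^sup>2) =
      measure_pmf.expectation ?Q (\<lambda>\<omega>. (g a)\<^sup>2 + 2 * g a * ?S \<omega> + (?S \<omega>)\<^sup>2)"
      by (simp add: power2_sum algebra_simps)
    also have "\<dots> = (g a)\<^sup>2 + 2 * g a * measure_pmf.expectation ?Q ?S + ?T"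
      by (simp add: int del: Bochner_Integration.integral_sum Bochner_Integration.integral_sum')
    finally show ?thesis using S0 by simp
  qed
  have "measure_pmf.expectation (Pi_pmf (insert j A) d (\<lambda>_. X)) (\<lambda>\<omega>. (\<Sum>i\<in>insert j A. g (\<omega> i))\<^sup>2) =
    measure_pmf.expectation (pair_pmf X ?Q) (\<lambda>(a, \<omega>). (g a + ?S \<omega>)\<^sup>2)"
    using insert.hyps by (subst Pi_pmf_insert) (simp_all only: integral_map_pmf case_prod_unfold upd not_False_eq_True)
  also have "\<dots> = measure_pmf.expectation X (\<lambda>a. measure_pmf.expectation ?Q (\<lambda>\<omega>. (g a + ?S \<omega>)\<^sup>2))"
    unfolding pair_pmf_def
    by (simp only: map_pmf_def[symmetric])
      (subst expectation_bind_finite, use fin finQ in auto)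
  also have "\<dots> = measure_pmf.expectation X (\<lambda>a. (g a)\<^sup>2) + ?T"
    by (simp add: inner int)
  finally show ?case using insert by (simp add: algebra_simps)
qed

lemma finite_set_sample_mean:
  assumes "finite (set_pmf X)"
  shows "finite (set_pmf (sample_mean N X g))"
  using assms by (simp add: sample_mean_def finite_set_Pi_pmf)

lemma expectation_sample_mean:
  assumes "finite (set_pmf X)" and "N > 0"
  shows "measure_pmf.expectation (sample_mean N X g) (\<lambda>x. x) = measure_pmf.expectation X g"
  using assms expectation_sum_Pi_pmf[of "{..<N}" X undefined g] by (simp add: sample_mean_def)

lemma variance_sample_mean:
  assumes fin: "finite (set_pmf X)" and "N > 0"
  shows "measure_pmf.expectation (sample_mean N X g) (\<lambda>x. (x - measure_pmf.expectation X g)\<^sup>2) =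
    measure_pmf.variance X g / real N"
proof -
  let ?m = "measure_pmf.expectation X g"
  let ?h = "\<lambda>x. g x - ?m"
  have "((\<Sum>i<N. g (\<omega> i)) / real N - ?m)\<^sup>2 = (\<Sum>i<N. ?h (\<omega> i))\<^sup>2 / (real N)\<^sup>2" for \<omega>
  proof -
    have "(\<Sum>i<N. ?h (\<omega> i)) = (\<Sum>i<N. g (\<omega> i)) - real N * ?m"
      by (simp add: sum_subtractf)
    then have "(\<Sum>i<N. g (\<omega> i)) / real N - ?m = (\<Sum>i<N. ?h (\<omega> i)) / real N"
      using \<open>N > 0\<close> by (simp add: diff_divide_distrib)
    then show ?thesis by (simp only: power_divide)
  qed
  moreover have "measure_pmf.expectation X ?h = 0"
    by (simp add: integrable_measure_pmf_finite[OF fin])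
  ultimately show ?thesis
    using expectation_sum_squared_Pi_pmf[of "{..<N}" X ?h undefined] fin \<open>N > 0\<close>
    by (simp add: sample_mean_def power2_eq_square)
qed

lemma prob_sample_mean_deviation:
  assumes fin: "finite (set_pmf X)" and "N > 0" and "a > 0"
  shows "measure_pmf.prob (sample_mean N X g) {x. \<bar>x - measure_pmf.expectation X g\<bar> \<ge> a}
    \<le> measure_pmf.variance X g / (real N * a\<^sup>2)"
proof -
  let ?M = "sample_mean N X g"
  have "measure_pmf.prob ?M {x \<in> space ?M. \<bar>x - measure_pmf.expectation ?M (\<lambda>x. x)\<bar> \<ge> a} \<le>
     measure_pmf.variance ?M (\<lambda>x. x) / a\<^sup>2"
    using fin \<open>a > 0\<close>
    by (intro measure_pmf.Chebyshev_inequality integrable_measure_pmf_finite finite_set_sample_mean) auto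
  then show ?thesis
    using variance_sample_mean[OF assms(1,2), of g] assms by (simp add: expectation_sample_mean)
qed

text \<open>The Bhatia-Davis inequality with lower end 0, from the pointwise bound
  \<open>(g x)\<^sup>2 \<le> M * g x\<close>. The factor \<open>M\<close> minus the mean is kept for
  the sake of the bound with probability 3/4.\<close>

lemma variance_le_bounded:
  fixes g :: "'a \<Rightarrow> real"
  assumes fin: "finite (set_pmf X)" and g: "\<And>x. x \<in> set_pmf X \<Longrightarrow> 0 \<le> g x \<and> g x \<le> M"
  shows "measure_pmf.variance X g \<le> measure_pmf.expectation X g * (M - measure_pmf.expectation X g)"
proof -
  note int = integrable_measure_pmf_finite[OF fin]
  have "measure_pmf.expectation X (\<lambda>x. (g x)\<^sup>2) \<le> measure_pmf.expectation X (\<lambda>x. M * g x)"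
    using g by (intro integral_mono_AE int) (auto simp: AE_measure_pmf_iff power2_eq_square mult_right_mono)
  then show ?thesis
    by (simp add: measure_pmf.variance_eq int power2_eq_square algebra_simps)
qed

text \<open>Expand \<open>1 / (x + s)\<close> around the mean \<open>v\<close>; the remainder is exactly
  \<open>(x - v)\<^sup>2 / ((x + s) * (v + s)\<^sup>2)\<close>.\<close>

lemma expectation_inverse_shifted_less_1:
  fixes V :: "real pmf"
  assumes fin: "finite (set_pmf V)" and nonneg: "\<And>x. x \<in> set_pmf V \<Longrightarrow> x \<ge> 0"
    and mean: "measure_pmf.expectation V (\<lambda>x. x) = v"
    and var: "measure_pmf.expectation V (\<lambda>x. (x - v)\<^sup>2) \<le> v * s\<^sup>2 / M"
    and "0 \<le> v" "v \<le> M" "0 < M" "0 < s"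
  shows "measure_pmf.expectation V (\<lambda>x. v / (x + s)) < 1"
proof -
  note int = integrable_measure_pmf_finite[OF fin]
  let ?b = "v + s"
  have b: "?b > 0" using assms by simp
  have taylor: "v / (x + s) \<le> v * (1 / ?b - (x - v) / ?b\<^sup>2 + (x - v)\<^sup>2 / (s * ?b\<^sup>2))" if "x \<ge> 0" for x
  proof -
    have "1 / (x + s) = 1 / ?b - (x - v) / ?b\<^sup>2 + (x - v)\<^sup>2 / ((x + s) * ?b\<^sup>2)"
    proof -
      have "?b\<^sup>2 = ?b * (x + s) - (x - v) * (x + s) + (x - v)\<^sup>2"
        by (simp add: power2_eq_square algebra_simps)
      then have "?b\<^sup>2 / ((x + s) * ?b\<^sup>2) =
        ?b * (x + s) / ((x + s) * ?b\<^sup>2) - (x - v) * (x + s) / ((x + s) * ?b\<^sup>2) + (x - v)\<^sup>2 / ((x + s) * ?b\<^sup>2)"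
        by (simp only: add_divide_distrib diff_divide_distrib)
      then show ?thesis using b that \<open>0 < s\<close> by (simp add: power2_eq_square)
    qed
    \<comment> \<open>Since \<open>x \<ge> 0\<close>, replacing \<open>x + s\<close> by
      \<open>s\<close> in the denominator of the remainder leaves a quadratic in \<open>x\<close>,
      whose expectation depends only on mean and variance.\<close>
    also have "\<dots> \<le> 1 / ?b - (x - v) / ?b\<^sup>2 + (x - v)\<^sup>2 / (s * ?b\<^sup>2)"
      using b that \<open>0 < s\<close> by (intro add_left_mono divide_left_mono mult_right_mono) auto
    finally show ?thesis using mult_left_mono[OF _ \<open>0 \<le> v\<close>] by fastforce
  qed
  have "measure_pmf.expectation V (\<lambda>x. v / (x + s)) \<le>
    measure_pmf.expectation V (\<lambda>x. v * (1 / ?b - (x - v) / ?b\<^sup>2 + (x - v)\<^sup>2 / (s * ?b\<^sup>2)))"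
    using nonneg taylor by (intro integral_mono_AE int) (auto simp: AE_measure_pmf_iff)
  also have "\<dots> = v * (1 / ?b + measure_pmf.expectation V (\<lambda>x. (x - v)\<^sup>2) / (s * ?b\<^sup>2))"
    by (simp add: int mean)
  also have "\<dots> \<le> v * (1 / ?b + (v * s\<^sup>2 / M) / (s * ?b\<^sup>2))"
    using var b assms by (intro mult_left_mono add_left_mono divide_right_mono) auto
  also have "\<dots> = v / ?b + (v / M) * (v * s / ?b\<^sup>2)"
  proof -
    have "v * (1 / b + (v * s\<^sup>2 / M) / (s * d)) = v / b + (v / M) * (v * s / d)" for b d
      using \<open>0 < s\<close> by (simp add: power2_eq_square distrib_left)
    then show ?thesis .
  qed
  \<comment> \<open>The correction is at most \<open>s / ?b\<close> times \<open>v / ?b\<close>, and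
    \<open>v / ?b < 1\<close> because \<open>s > 0\<close>. Hence the total is strictly below
    \<open>v / ?b + s / ?b\<close>.\<close>
  also have "\<dots> \<le> v / ?b + 1 * (v * s / ?b\<^sup>2)"
    using assms by (intro add_left_mono mult_right_mono) auto
  also have "\<dots> < v / ?b + s / ?b"
  proof -
    have "v * s / ?b\<^sup>2 = (s / ?b) * (v / ?b)" by (simp add: power2_eq_square)
    also have "\<dots> < (s / ?b) * 1" using b \<open>0 < s\<close> by (intro mult_strict_left_mono) auto
    finally show ?thesis by simp
  qed
  also have "\<dots> = 1" using b by (simp flip: add_divide_distrib)
  finally show ?thesis .
qed

section \<open>Moments of the path estimator\<close>

text \<open>AM-GM for the numbers \<open>x i ^ l\<close>, whose geometric mean is the product of the
  \<open>x i\<close>.\<close>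

lemma prod_le_mean_power:
  fixes x :: "nat \<Rightarrow> real"
  assumes "l \<ge> 1" and "\<And>i. i < l \<Longrightarrow> x i \<ge> 0"
  shows "(\<Prod>i<l. x i) \<le> (\<Sum>i<l. x i ^ l) / real l"
proof -
  have p: "(\<Prod>i<l. x i) \<ge> 0" using assms by (auto intro!: prod_nonneg)
  have "(\<Prod>i<l. x i ^ l) powr (1 / card {..<l}) \<le> (\<Sum>i<l. x i ^ l / card {..<l})"
    using assms by (intro arith_geom_mean) (auto simp: lessThan_empty_iff)
  \<comment> \<open>A zero product is treated separately, since \<open>powr_realpow\<close> asks for
    a positive base.\<close>
  moreover have "(\<Prod>i<l. x i ^ l) powr (1 / card {..<l}) = (\<Prod>i<l. x i)"
    using p assms(1) unfolding prod_power_distrib[symmetric]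
    by (cases "(\<Prod>i<l. x i) = 0")
      (simp_all add: powr_realpow[symmetric] powr_powr del: prod_zero_iff)
  ultimately show ?thesis by (simp add: sum_divide_distrib)
qed

section \<open>Paths of the Markov chain from a fixed start\<close>

lemma Hnorm_nonneg: "Hnorm n \<Gamma> k \<sigma> \<ge> 0"
  by (simp add: Hnorm_def sum_nonneg)

lemma Hmat_sym: "Hmat n \<Gamma> k \<tau> \<sigma> = Hmat n \<Gamma> k \<sigma> \<tau>"
  by (simp add: Hmat_def laplacian_def mult.commute)

lemma set_pmf_transition:
  assumes "is_simplicial_complex n \<Gamma>" and "\<sigma> \<in> simplices \<Gamma> k"
  shows "set_pmf (transition n \<Gamma> k \<sigma>) \<subseteq> simplices \<Gamma> k"
proof (cases "Hnorm n \<Gamma> k \<sigma> = 0")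
  case True
  then show ?thesis using assms(2) by (simp add: transition_def)
next
  case False
  then show ?thesis using pmf_transition[OF assms(1) False] by (auto simp: set_pmf_eq split: if_splits)
qed

text \<open>The product form also covers zero columns, because a vanishing norm forces every entry
  of the column to be 0. The computation of the mean then needs no case distinction.\<close>

lemma pmf_transition_mult_Hnorm:
  assumes "is_simplicial_complex n \<Gamma>" and "\<tau> \<in> simplices \<Gamma> k"
  shows "pmf (transition n \<Gamma> k \<sigma>) \<tau> * Hnorm n \<Gamma> k \<sigma> = \<bar>Hmat n \<Gamma> k \<tau> \<sigma>\<bar>"
proof (cases "Hnorm n \<Gamma> k \<sigma> = 0")
  case True
  then have "Hmat n \<Gamma> k \<tau> \<sigma> = 0"
    using assms finite_simplices[OF assms(1)]
    by (auto simp: Hnorm_def sum_nonneg_eq_0_iff)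
  then show ?thesis using True by simp
next
  case False
  then show ?thesis using assms by (simp add: pmf_transition)
qed

lemma path_from_nth_0: "p \<in> set_pmf (path_from n \<Gamma> k l \<sigma>) \<Longrightarrow> p ! 0 = \<sigma>"
  by (cases l) auto

lemma finite_set_path_from:
  assumes "is_simplicial_complex n \<Gamma>" and "\<sigma> \<in> simplices \<Gamma> k"
  shows "finite (set_pmf (path_from n \<Gamma> k l \<sigma>))"
  using assms(2)
proof (induction l arbitrary: \<sigma>)
  case (Suc l)
  then show ?case
    using set_pmf_transition[OF assms(1) Suc.prems] finite_simplices[OF assms(1), of k]
    by (auto intro!: finite_UN_I intro: finite_subset)
qed simp

lemma expectation_path_from_Suc:
  fixes F :: "nat set list \<Rightarrow> real"
  assumes sc: "is_simplicial_complex n \<Gamma>" and "\<sigma> \<in> simplices \<Gamma> k"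
  shows "measure_pmf.expectation (path_from n \<Gamma> k (Suc l) \<sigma>) F =
    (\<Sum>\<rho>\<in>simplices \<Gamma> k. pmf (transition n \<Gamma> k \<sigma>) \<rho> *
      measure_pmf.expectation (path_from n \<Gamma> k l \<rho>) (\<lambda>p. F (\<sigma> # p)))"
  using assms set_pmf_transition[OF assms] finite_set_path_from[OF sc]
  by (simp add: pmf_expectation_bind[of "simplices \<Gamma> k"] finite_simplices[OF sc])

text \<open>Paths from \<open>\<sigma>\<close> almost surely begin with \<open>\<sigma>\<close>, so
  under the expectation \<open>p ! 0\<close> may be replaced by the fixed start.\<close>

lemma expectation_path_from_cong:
  fixes F G :: "nat set list \<Rightarrow> real"
  assumes "\<And>p. p ! 0 = \<sigma> \<Longrightarrow> F p = G p"
  shows "measure_pmf.expectation (path_from n \<Gamma> k l \<sigma>) F =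
    measure_pmf.expectation (path_from n \<Gamma> k l \<sigma>) G"
  using assms path_from_nth_0 by (intro integral_cong_AE) (auto simp: AE_measure_pmf_iff)

text \<open>Conditioning on the first step gives the recursion of \<open>mat_power\<close>, each
  transition probability being multiplied by its weight. Signed column norms as \<open>w\<close>
  produce powers of \<open>H\<close>; the constant weight 1 produces the multi-step probabilities
  \<open>step_prob\<close>.\<close>

lemma expectation_path_weight:
  assumes sc: "is_simplicial_complex n \<Gamma>" and "\<sigma> \<in> simplices \<Gamma> k"
  shows "measure_pmf.expectation (path_from n \<Gamma> k l \<sigma>)
      (\<lambda>p. (if p ! l = \<tau> then 1 else 0) * (\<Prod>i<l. w (p ! i) (p ! Suc i))) =
    mat_power (simplices \<Gamma> k) (\<lambda>\<sigma> \<tau>. pmf (transition n \<Gamma> k \<sigma>) \<tau> * w \<sigma> \<tau>) l \<sigma> \<tau>"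
  using assms(2)
proof (induction l arbitrary: \<sigma>)
  case (Suc l)
  let ?g = "\<lambda>p. (if p ! l = \<tau> then 1 else 0) * (\<Prod>i<l. w (p ! i) (p ! Suc i))"
  have "measure_pmf.expectation (path_from n \<Gamma> k l \<rho>)
      (\<lambda>p. (if (\<sigma> # p) ! Suc l = \<tau> then 1 else 0) * (\<Prod>i<Suc l. w ((\<sigma> # p) ! i) ((\<sigma> # p) ! Suc i))) =
     measure_pmf.expectation (path_from n \<Gamma> k l \<rho>) (\<lambda>p. w \<sigma> \<rho> * ?g p)" for \<rho>
    by (rule expectation_path_from_cong) (simp add: prod.lessThan_Suc_shift del: prod.lessThan_Suc)
  then show ?case
    using Suc by (simp add: expectation_path_from_Suc[OF sc] mult.assoc del: path_from.simps prod.lessThan_Suc)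
qed auto

definition step_prob :: "nat \<Rightarrow> nat set set \<Rightarrow> nat \<Rightarrow> nat \<Rightarrow> nat set \<Rightarrow> nat set \<Rightarrow> real" where
  "step_prob n \<Gamma> k = mat_power (simplices \<Gamma> k) (\<lambda>\<sigma>. pmf (transition n \<Gamma> k \<sigma>))"

lemma step_prob_nonneg: "step_prob n \<Gamma> k j \<sigma> \<tau> \<ge> 0"
  unfolding step_prob_def by (induction j arbitrary: \<sigma>) (auto intro!: sum_nonneg)

lemma sum_step_prob:
  assumes sc: "is_simplicial_complex n \<Gamma>" and "\<sigma> \<in> simplices \<Gamma> k"
  shows "(\<Sum>\<tau>\<in>simplices \<Gamma> k. step_prob n \<Gamma> k j \<sigma> \<tau>) = 1"
  using assms(2)
proof (induction j arbitrary: \<sigma>)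
  case 0
  then show ?case by (simp add: step_prob_def finite_simplices[OF sc])
next
  case (Suc j)
  let ?S = "simplices \<Gamma> k"
  have "(\<Sum>\<tau>\<in>?S. step_prob n \<Gamma> k (Suc j) \<sigma> \<tau>) =
    (\<Sum>\<rho>\<in>?S. pmf (transition n \<Gamma> k \<sigma>) \<rho> * (\<Sum>\<tau>\<in>?S. step_prob n \<Gamma> k j \<rho> \<tau>))"
    by (simp add: step_prob_def sum_distrib_left) (rule sum.swap)
  also have "\<dots> = (\<Sum>\<rho>\<in>?S. pmf (transition n \<Gamma> k \<sigma>) \<rho>)"
    using Suc.IH by simp
  also have "\<dots> = 1"
    using set_pmf_transition[OF sc Suc.prems] by (intro sum_pmf_eq_1 finite_simplices[OF sc])
  finally show ?case .
qed

lemma step_prob_le_1: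
  assumes sc: "is_simplicial_complex n \<Gamma>" and "\<sigma> \<in> simplices \<Gamma> k" and "\<tau> \<in> simplices \<Gamma> k"
  shows "step_prob n \<Gamma> k j \<sigma> \<tau> \<le> 1"
  using member_le_sum[OF assms(3), of "step_prob n \<Gamma> k j \<sigma>"] finite_simplices[OF sc, of k]
    sum_step_prob[OF assms(1,2), of j] step_prob_nonneg by auto

text \<open>The Markov property at time \<open>j\<close>: a path factors into \<open>j\<close> steps
  to \<open>\<rho>\<close> and \<open>l - j\<close> steps on to \<open>\<tau>\<close>. With
  \<open>\<tau>\<close> the start itself, this handles a weight attached to one position of a closed
  path.\<close>

lemma expectation_path_visit:
  assumes sc: "is_simplicial_complex n \<Gamma>" and "\<sigma> \<in> simplices \<Gamma> k" and "j \<le> l"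
  shows "measure_pmf.expectation (path_from n \<Gamma> k l \<sigma>)
      (\<lambda>p. (if p ! l = \<tau> then 1 else 0) * h (p ! j)) =
    (\<Sum>\<rho>\<in>simplices \<Gamma> k. step_prob n \<Gamma> k j \<sigma> \<rho> * h \<rho> * step_prob n \<Gamma> k (l - j) \<rho> \<tau>)"
  using assms(2,3)
proof (induction j arbitrary: \<sigma> l)
  case 0
  have "measure_pmf.expectation (path_from n \<Gamma> k l \<sigma>) (\<lambda>p. (if p ! l = \<tau> then 1 else 0) * h (p ! 0)) =
    measure_pmf.expectation (path_from n \<Gamma> k l \<sigma>)
      (\<lambda>p. h \<sigma> * ((if p ! l = \<tau> then 1 else 0) * (\<Prod>i<l. 1)))"
    by (rule expectation_path_from_cong) simp
  also have "\<dots> = h \<sigma> * step_prob n \<Gamma> k l \<sigma> \<tau>"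
    using expectation_path_weight[OF sc 0(1), of l \<tau> "\<lambda>_ _. 1"] by (simp add: step_prob_def)
  also have "\<dots> = (\<Sum>\<rho>\<in>simplices \<Gamma> k. if \<rho> = \<sigma> then h \<rho> * step_prob n \<Gamma> k l \<rho> \<tau> else 0)"
    using 0 by (simp add: finite_simplices[OF sc])
  also have "\<dots> = (\<Sum>\<rho>\<in>simplices \<Gamma> k. step_prob n \<Gamma> k 0 \<sigma> \<rho> * h \<rho> * step_prob n \<Gamma> k (l - 0) \<rho> \<tau>)"
    by (rule sum.cong) (auto simp: step_prob_def)
  finally show ?case .
next
  case (Suc j)
  then obtain m where l: "l = Suc m" and "j \<le> m" by (cases l) auto
  let ?S = "simplices \<Gamma> k"
  have "measure_pmf.expectation (path_from n \<Gamma> k l \<sigma>)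
      (\<lambda>p. (if p ! l = \<tau> then 1 else 0) * h (p ! Suc j)) =
    (\<Sum>\<rho>'\<in>?S. pmf (transition n \<Gamma> k \<sigma>) \<rho>' *
      (\<Sum>\<rho>\<in>?S. step_prob n \<Gamma> k j \<rho>' \<rho> * h \<rho> * step_prob n \<Gamma> k (m - j) \<rho> \<tau>))"
    using Suc.IH[OF _ \<open>j \<le> m\<close>] Suc.prems
    by (simp add: l expectation_path_from_Suc[OF sc] del: path_from.simps)
  also have "\<dots> = (\<Sum>\<rho>\<in>?S. \<Sum>\<rho>'\<in>?S. pmf (transition n \<Gamma> k \<sigma>) \<rho>' *
      (step_prob n \<Gamma> k j \<rho>' \<rho> * h \<rho> * step_prob n \<Gamma> k (m - j) \<rho> \<tau>))"
    unfolding sum_distrib_left by (rule sum.swap)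
  also have "\<dots> = (\<Sum>\<rho>\<in>?S. step_prob n \<Gamma> k (Suc j) \<sigma> \<rho> * h \<rho> * step_prob n \<Gamma> k (l - Suc j) \<rho> \<tau>)"
    by (simp add: step_prob_def l sum_distrib_right mult.assoc)
  finally show ?case .
qed

section \<open>Mean and second moment under a uniform start\<close>

lemma finite_set_random_path:
  assumes "is_simplicial_complex n \<Gamma>" and "simplices \<Gamma> k \<noteq> {}"
  shows "finite (set_pmf (random_path n \<Gamma> k l))"
  using assms by (auto simp: random_path_def finite_simplices finite_set_path_from)

lemma expectation_random_path:
  fixes F :: "nat set list \<Rightarrow> real"
  assumes "is_simplicial_complex n \<Gamma>" and "simplices \<Gamma> k \<noteq> {}"
  shows "measure_pmf.expectation (random_path n \<Gamma> k l) F =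
    1 / real (card (simplices \<Gamma> k)) *
      (\<Sum>\<sigma>\<in>simplices \<Gamma> k. measure_pmf.expectation (path_from n \<Gamma> k l \<sigma>) F)"
  unfolding random_path_def
  using assms by (subst pmf_expectation_bind_pmf_of_set)
    (auto simp: finite_simplices finite_set_path_from sum_distrib_left field_simps)

lemma mat_power_cong:
  assumes "\<And>\<sigma> \<tau>. \<sigma> \<in> S \<Longrightarrow> \<tau> \<in> S \<Longrightarrow> A \<sigma> \<tau> = B \<sigma> \<tau>" and "\<sigma> \<in> S"
  shows "mat_power S A l \<sigma> \<tau> = mat_power S B l \<sigma> \<tau>"
  using assms(2) by (induction l arbitrary: \<sigma>) (auto simp: assms(1))

text \<open>This is importance sampling: the weight of each step cancels the normalisation in the
  transition probability and restores the sign, so closed paths from \<open>\<sigma>\<close> have as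
  expected weight a diagonal entry of the power of \<open>H\<close>.\<close>

lemma expectation_path_value:
  assumes sc: "is_simplicial_complex n \<Gamma>" and ne: "simplices \<Gamma> k \<noteq> {}"
  shows "measure_pmf.expectation (random_path n \<Gamma> k l) (path_value n \<Gamma> k l) =
    1 / real (card (simplices \<Gamma> k)) *
      mat_trace (simplices \<Gamma> k) (mat_power (simplices \<Gamma> k) (Hmat n \<Gamma> k) l)"
proof -
  let ?S = "simplices \<Gamma> k"
  let ?w = "\<lambda>\<sigma> \<tau>. sgn (Hmat n \<Gamma> k \<sigma> \<tau>) * Hnorm n \<Gamma> k \<sigma>"
  \<comment> \<open>The chain uses column \<open>\<sigma>\<close> of \<open>H\<close>, but the sign
    is read from row \<open>\<sigma>\<close>; the symmetry of \<open>H\<close> reconciles the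
    two.\<close>
  have w: "pmf (transition n \<Gamma> k \<sigma>) \<tau> * ?w \<sigma> \<tau> = Hmat n \<Gamma> k \<sigma> \<tau>" if "\<tau> \<in> ?S" for \<sigma> \<tau>
  proof -
    have "pmf (transition n \<Gamma> k \<sigma>) \<tau> * ?w \<sigma> \<tau> =
      sgn (Hmat n \<Gamma> k \<sigma> \<tau>) * (pmf (transition n \<Gamma> k \<sigma>) \<tau> * Hnorm n \<Gamma> k \<sigma>)"
      by simp
    also have "\<dots> = sgn (Hmat n \<Gamma> k \<sigma> \<tau>) * \<bar>Hmat n \<Gamma> k \<sigma> \<tau>\<bar>"
      by (simp only: pmf_transition_mult_Hnorm[OF sc that] Hmat_sym[of n \<Gamma> k \<tau> \<sigma>])
    finally show ?thesis by (simp add: sgn_mult_abs)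
  qed
  have "measure_pmf.expectation (path_from n \<Gamma> k l \<sigma>) (path_value n \<Gamma> k l) =
    mat_power ?S (Hmat n \<Gamma> k) l \<sigma> \<sigma>" if "\<sigma> \<in> ?S" for \<sigma>
  proof -
    have "measure_pmf.expectation (path_from n \<Gamma> k l \<sigma>) (path_value n \<Gamma> k l) =
      measure_pmf.expectation (path_from n \<Gamma> k l \<sigma>)
        (\<lambda>p. (if p ! l = \<sigma> then 1 else 0) * (\<Prod>i<l. ?w (p ! i) (p ! Suc i)))"
      by (rule expectation_path_from_cong) (simp add: path_value_def)
    also have "\<dots> = mat_power ?S (Hmat n \<Gamma> k) l \<sigma> \<sigma>"
      unfolding expectation_path_weight[OF sc that, of l \<sigma> ?w]
      using w that by (intro mat_power_cong) auto
    finally show ?thesis .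
  qed
  then show ?thesis
    by (simp add: expectation_random_path[OF sc ne] mat_trace_def)
qed

text \<open>Squaring removes the signs, and AM-GM is applied to the squared norms. The product along
  the path becomes a sum of functions of one visited simplex each, to which
  \<open>expectation_path_visit\<close> applies.\<close>

lemma path_value_squared_le:
  assumes "l \<ge> 1"
  shows "(path_value n \<Gamma> k l p)\<^sup>2 \<le>
    (\<Sum>j<l. (if p ! l = p ! 0 then 1 else 0) * Hnorm n \<Gamma> k (p ! j) ^ (2 * l)) / real l"
proof -
  have "(\<Prod>i<l. (sgn (Hmat n \<Gamma> k (p ! i) (p ! Suc i)) * Hnorm n \<Gamma> k (p ! i))\<^sup>2) \<le>
    (\<Prod>i<l. (Hnorm n \<Gamma> k (p ! i))\<^sup>2)"
    by (intro prod_mono) (auto simp: power_mult_distrib sgn_if)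
  also have "\<dots> \<le> (\<Sum>i<l. ((Hnorm n \<Gamma> k (p ! i))\<^sup>2) ^ l) / real l"
    using assms by (intro prod_le_mean_power) auto
  finally show ?thesis
    by (simp add: path_value_def power_mult_distrib prod_power_distrib power_mult)
qed

lemma second_moment_path_value:
  assumes sc: "is_simplicial_complex n \<Gamma>" and ne: "simplices \<Gamma> k \<noteq> {}" and "l \<ge> 1"
  shows "measure_pmf.expectation (random_path n \<Gamma> k l) (\<lambda>p. (path_value n \<Gamma> k l p)\<^sup>2) \<le>
    1 / real (card (simplices \<Gamma> k)) * (\<Sum>\<sigma>\<in>simplices \<Gamma> k. Hnorm n \<Gamma> k \<sigma> ^ (2 * l))"
proof -
  let ?S = "simplices \<Gamma> k" and ?Q = "step_prob n \<Gamma> k"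
  let ?h = "\<lambda>\<rho>. Hnorm n \<Gamma> k \<rho> ^ (2 * l)"
  have h: "?h \<rho> \<ge> 0" for \<rho> by (simp add: Hnorm_nonneg)
  have "(\<Sum>\<sigma>\<in>?S. measure_pmf.expectation (path_from n \<Gamma> k l \<sigma>) (\<lambda>p. (path_value n \<Gamma> k l p)\<^sup>2)) \<le>
    (\<Sum>\<sigma>\<in>?S. (\<Sum>j<l. \<Sum>\<rho>\<in>?S. ?Q j \<sigma> \<rho> * ?h \<rho> * ?Q (l - j) \<rho> \<sigma>) / real l)"
  proof (rule sum_mono)
    fix \<sigma> assume s: "\<sigma> \<in> ?S"
    note int = integrable_measure_pmf_finite[OF finite_set_path_from[OF sc s]]
    have "measure_pmf.expectation (path_from n \<Gamma> k l \<sigma>) (\<lambda>p. (path_value n \<Gamma> k l p)\<^sup>2) \<le>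
      measure_pmf.expectation (path_from n \<Gamma> k l \<sigma>)
        (\<lambda>p. (\<Sum>j<l. (if p ! l = p ! 0 then 1 else 0) * ?h (p ! j)) / real l)"
      by (intro integral_mono int path_value_squared_le \<open>l \<ge> 1\<close>)
    also have "\<dots> = measure_pmf.expectation (path_from n \<Gamma> k l \<sigma>)
        (\<lambda>p. (\<Sum>j<l. (if p ! l = \<sigma> then 1 else 0) * ?h (p ! j)) / real l)"
      by (rule expectation_path_from_cong) simp
    also have "\<dots> = (\<Sum>j<l. measure_pmf.expectation (path_from n \<Gamma> k l \<sigma>)
        (\<lambda>p. (if p ! l = \<sigma> then 1 else 0) * ?h (p ! j))) / real l"
      by (subst integral_divide_zero, subst Bochner_Integration.integral_sum) (auto intro: int)
    also have "\<dots> = (\<Sum>j<l. \<Sum>\<rho>\<in>?S. ?Q j \<sigma> \<rho> * ?h \<rho> * ?Q (l - j) \<rho> \<sigma>) / real l"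
      using expectation_path_visit[OF sc s less_imp_le, where h = ?h]
      by (intro arg_cong2[where f = "(/)"] sum.cong) auto
    finally show "measure_pmf.expectation (path_from n \<Gamma> k l \<sigma>) (\<lambda>p. (path_value n \<Gamma> k l p)\<^sup>2) \<le>
      (\<Sum>j<l. \<Sum>\<rho>\<in>?S. ?Q j \<sigma> \<rho> * ?h \<rho> * ?Q (l - j) \<rho> \<sigma>) / real l" .
  qed
  \<comment> \<open>With the sum over the start \<open>\<sigma>\<close> innermost, a closed path
    through \<open>\<rho>\<close> at time \<open>j\<close> is read as starting at
    \<open>\<rho>\<close>; the inner sum is the probability of being back at \<open>\<rho>\<close>
    after \<open>l\<close> steps.\<close>
  also have "\<dots> = (\<Sum>j<l. \<Sum>\<rho>\<in>?S. ?h \<rho> * (\<Sum>\<sigma>\<in>?S. ?Q (l - j) \<rho> \<sigma> * ?Q j \<sigma> \<rho>)) / real l"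
  proof -
    have "(\<Sum>\<sigma>\<in>?S. \<Sum>j<l. \<Sum>\<rho>\<in>?S. ?Q j \<sigma> \<rho> * ?h \<rho> * ?Q (l - j) \<rho> \<sigma>) =
      (\<Sum>j<l. \<Sum>\<sigma>\<in>?S. \<Sum>\<rho>\<in>?S. ?Q j \<sigma> \<rho> * ?h \<rho> * ?Q (l - j) \<rho> \<sigma>)"
      by (rule sum.swap)
    also have "\<dots> = (\<Sum>j<l. \<Sum>\<rho>\<in>?S. \<Sum>\<sigma>\<in>?S. ?Q j \<sigma> \<rho> * ?h \<rho> * ?Q (l - j) \<rho> \<sigma>)"
      by (intro sum.cong refl sum.swap)
    finally show ?thesis by (simp add: sum_divide_distrib[symmetric] sum_distrib_left mult_ac)
  qed
  also have "\<dots> \<le> (\<Sum>j<l. \<Sum>\<rho>\<in>?S. ?h \<rho> * 1) / real l"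
  proof (intro divide_right_mono sum_mono mult_left_mono h)
    fix j \<rho> assume r: "\<rho> \<in> ?S"
    have "(\<Sum>\<sigma>\<in>?S. ?Q (l - j) \<rho> \<sigma> * ?Q j \<sigma> \<rho>) \<le> (\<Sum>\<sigma>\<in>?S. ?Q (l - j) \<rho> \<sigma> * 1)"
      using r by (intro sum_mono mult_left_mono step_prob_nonneg step_prob_le_1[OF sc])
    also have "\<dots> = 1" using sum_step_prob[OF sc r] by simp
    finally show "(\<Sum>\<sigma>\<in>?S. ?Q (l - j) \<rho> \<sigma> * ?Q j \<sigma> \<rho>) \<le> 1" .
  qed simp
  also have "\<dots> = (\<Sum>\<rho>\<in>?S. ?h \<rho>)" using \<open>l \<ge> 1\<close> by simp
  finally show ?thesis
    unfolding expectation_random_path[OF sc ne] by (intro mult_left_mono) auto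
qed

section \<open>Column norms of \<open>H\<close>\<close>

text \<open>For \<open>v \<in> \<sigma>\<close>, the coefficient of the face
  \<open>\<sigma> - {v}\<close> in the boundary of \<open>\<sigma>\<close>. The zero-based position
  of \<open>v\<close> is written as the number of smaller vertices, which is easy to track when
  another vertex is removed.\<close>

definition face_sign :: "nat set \<Rightarrow> nat \<Rightarrow> real" where
  "face_sign \<sigma> v = (-1) ^ (card {x \<in> \<sigma>. x < v} + 1)"

lemma abs_face_sign [simp]: "\<bar>face_sign \<sigma> v\<bar> = 1"
  by (simp add: face_sign_def power_abs)

lemma face_sign_square [simp]: "face_sign \<sigma> v * face_sign \<sigma> v = 1"
  by (simp add: face_sign_def flip: power_mult_distrib)

text \<open>The sign rule behind \<open>\<partial>\<partial> = 0\<close>: deleting the smaller of two vertices shifts the position of the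
  larger one.\<close>

lemma face_sign_anticomm:
  assumes "finite \<rho>" "v \<in> \<rho>" "w \<in> \<rho>" "v \<noteq> w"
  shows "face_sign \<rho> v * face_sign \<rho> w = - (face_sign (\<rho> - {v}) w * face_sign (\<rho> - {w}) v)"
proof -
  have less: "face_sign \<rho> v * face_sign \<rho> w = - (face_sign (\<rho> - {v}) w * face_sign (\<rho> - {w}) v)"
    if "v \<in> \<rho>" "v < w" for v w
  proof -
    have "{x \<in> \<rho> - {v}. x < w} = {x \<in> \<rho>. x < w} - {v}" by auto
    then have "card {x \<in> \<rho>. x < w} = Suc (card {x \<in> \<rho> - {v}. x < w})"
      using that \<open>finite \<rho>\<close> card_Suc_Diff1[of "{x \<in> \<rho>. x < w}" v] by simp
    moreover have "{x \<in> \<rho> - {w}. x < v} = {x \<in> \<rho>. x < v}" using that by auto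
    ultimately show ?thesis by (simp add: face_sign_def)
  qed
  show ?thesis
  proof (cases "v < w")
    case True
    then show ?thesis using less assms by blast
  next
    case False
    then have "w < v" using \<open>v \<noteq> w\<close> by simp
    from less[OF \<open>w \<in> \<rho>\<close> this] show ?thesis by (metis mult.commute)
  qed
qed

text \<open>Only the index \<open>j\<close> at which the sorted list has \<open>v\<close>
  contributes to the sum, and since the list is strictly increasing, \<open>j\<close> is the number
  of vertices below \<open>v\<close>.\<close>

lemma boundary_remove:
  assumes "finite \<sigma>" "card \<sigma> = k + 1" "v \<in> \<sigma>"
  shows "boundary k (\<sigma> - {v}) \<sigma> = face_sign \<sigma> v"
proof -
  let ?xs = "sorted_list_of_set \<sigma>"
  have len: "length ?xs = k + 1" and set: "set ?xs = \<sigma>" and str: "sorted_wrt (<) ?xs"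
    using assms by simp_all
  have nth_less: "?xs ! i < ?xs ! j" if "i < j" "j \<le> k" for i j
    using sorted_wrt_nth_less[OF str] that len by simp
  obtain j where j: "j \<le> k" "?xs ! j = v"
    using assms(3) len set by (metis in_set_conv_nth less_Suc_eq_le Suc_eq_plus1)
  have mem: "?xs ! i \<in> \<sigma>" if "i \<le> k" for i using that len set nth_mem[of i ?xs] by simp
  have eq: "\<sigma> - {v} = \<sigma> - {?xs ! i} \<longleftrightarrow> i = j" if "i \<le> k" for i
  proof -
    have "\<sigma> - {v} = \<sigma> - {?xs ! i} \<longleftrightarrow> v = ?xs ! i" using mem[OF that] assms(3) by auto
    also have "\<dots> \<longleftrightarrow> i = j" using nth_less[of i j] nth_less[of j i] j that
      by (metis less_irrefl linorder_neqE_nat)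
    finally show ?thesis .
  qed
  have "{x \<in> \<sigma>. x < v} = (!) ?xs ` {..<j}"
  proof (intro equalityI subsetI)
    fix x assume "x \<in> {x \<in> \<sigma>. x < v}"
    then obtain i where i: "i \<le> k" "?xs ! i = x" and "x < v"
      using len set by (metis (mono_tags, lifting) in_set_conv_nth less_Suc_eq_le Suc_eq_plus1 mem_Collect_eq)
    have "i < j"
    proof (rule ccontr)
      assume "\<not> i < j"
      then have "v \<le> x" using nth_less[of j i] i j by (cases "i = j") auto
      then show False using \<open>x < v\<close> by simp
    qed
    then show "x \<in> (!) ?xs ` {..<j}" using i by auto
  qed (use nth_less j mem in auto)
  moreover have "inj_on ((!) ?xs) {..<j}"
    using j len by (auto simp: inj_on_def nth_eq_iff_index_eq)
  ultimately have card: "card {x \<in> \<sigma>. x < v} = j" by (simp add: card_image)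
  have "boundary k (\<sigma> - {v}) \<sigma> = (\<Sum>i\<le>k. if i = j then (-1) ^ (i + 1) else 0)"
    unfolding boundary_def by (intro sum.cong) (auto simp: eq)
  then show ?thesis using j by (simp add: face_sign_def card)
qed

lemma boundary_nonzeroD:
  assumes "boundary k \<rho> \<sigma> \<noteq> 0" "finite \<sigma>" "card \<sigma> = k + 1"
  shows "\<exists>v\<in>\<sigma>. \<rho> = \<sigma> - {v}"
proof -
  obtain j where "j \<le> k" "\<rho> = \<sigma> - {sorted_list_of_set \<sigma> ! j}"
    using assms(1) unfolding boundary_def by (auto elim!: sum.not_neutral_contains_not_neutral split: if_splits)
  moreover have "sorted_list_of_set \<sigma> ! j \<in> \<sigma>"
    using nth_mem[of j "sorted_list_of_set \<sigma>"] assms(2,3) \<open>j \<le> k\<close> by simp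
  ultimately show ?thesis by blast
qed

section \<open>Entries of the Laplacian\<close>

lemma simplicesD:
  assumes "is_simplicial_complex n \<Gamma>" "\<sigma> \<in> simplices \<Gamma> k"
  shows "finite \<sigma>" "card \<sigma> = k + 1" "\<sigma> \<subseteq> {1..n}" "\<sigma> \<in> \<Gamma>"
  using assms by (auto simp: simplices_def is_simplicial_complex_def intro: finite_subset)

text \<open>\<open>k > 0\<close> makes \<open>k - 1\<close> a true predecessor, so that the
  \<open>k\<close> vertices of the face match the required \<open>k - 1 + 1\<close>.\<close>

lemma face_in_simplices:
  assumes "is_simplicial_complex n \<Gamma>" "\<sigma> \<in> simplices \<Gamma> k" "k > 0" "v \<in> \<sigma>"
  shows "\<sigma> - {v} \<in> simplices \<Gamma> (k - 1)"
  using simplicesD[OF assms(1,2)] assms unfolding simplices_def is_simplicial_complex_def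
  by (auto simp: card_Diff_singleton)

text \<open>Cofaces are recorded by the added vertex, so that they can be counted within
  \<open>{1..n}\<close>.\<close>

definition coface_vertices :: "nat \<Rightarrow> nat set set \<Rightarrow> nat set \<Rightarrow> nat set" where
  "coface_vertices n \<Gamma> \<sigma> = {w \<in> {1..n} - \<sigma>. insert w \<sigma> \<in> \<Gamma>}"

text \<open>Each of the \<open>k + 1\<close> faces and each coface contributes the square of a
  sign.\<close>

lemma laplacian_diag:
  assumes sc: "is_simplicial_complex n \<Gamma>" and s: "\<sigma> \<in> simplices \<Gamma> k" and "k > 0"
  shows "laplacian \<Gamma> k \<sigma> \<sigma> = real (k + 1) + real (card (coface_vertices n \<Gamma> \<sigma>))"
proof -
  note sD = simplicesD[OF sc s]
  let ?U = "coface_vertices n \<Gamma> \<sigma>"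
  have "(\<Sum>\<rho>\<in>simplices \<Gamma> (k - 1). boundary k \<rho> \<sigma> * boundary k \<rho> \<sigma>) =
    (\<Sum>\<rho>\<in>(\<lambda>v. \<sigma> - {v}) ` \<sigma>. boundary k \<rho> \<sigma> * boundary k \<rho> \<sigma>)"
    using face_in_simplices[OF sc s \<open>k > 0\<close>] boundary_nonzeroD[OF _ sD(1,2)]
    by (intro sum.mono_neutral_right finite_simplices[OF sc]) auto
  also have "\<dots> = (\<Sum>v\<in>\<sigma>. boundary k (\<sigma> - {v}) \<sigma> * boundary k (\<sigma> - {v}) \<sigma>)"
    by (subst sum.reindex) (auto simp: inj_on_def)
  also have "\<dots> = real (k + 1)"
    using sD by (simp add: boundary_remove)
  finally have 1: "(\<Sum>\<rho>\<in>simplices \<Gamma> (k - 1). boundary k \<rho> \<sigma> * boundary k \<rho> \<sigma>) = real (k + 1)" .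
  have cof: "insert w \<sigma> \<in> simplices \<Gamma> (k + 1)" if "w \<in> ?U" for w
    using that sD by (auto simp: coface_vertices_def simplices_def)
  have "(\<Sum>\<rho>\<in>simplices \<Gamma> (k + 1). boundary (k + 1) \<sigma> \<rho> * boundary (k + 1) \<sigma> \<rho>) =
    (\<Sum>\<rho>\<in>(\<lambda>w. insert w \<sigma>) ` ?U. boundary (k + 1) \<sigma> \<rho> * boundary (k + 1) \<sigma> \<rho>)"
  proof (intro sum.mono_neutral_right finite_simplices[OF sc] ballI)
    fix \<rho> assume r: "\<rho> \<in> simplices \<Gamma> (k + 1) - (\<lambda>w. insert w \<sigma>) ` ?U"
    then have rD: "finite \<rho>" "card \<rho> = k + 1 + 1" "\<rho> \<subseteq> {1..n}" "\<rho> \<in> \<Gamma>"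
      using simplicesD[OF sc, of \<rho> "k + 1"] by auto
    have "boundary (k + 1) \<sigma> \<rho> = 0"
    proof (rule ccontr)
      assume "boundary (k + 1) \<sigma> \<rho> \<noteq> 0"
      then obtain v where "v \<in> \<rho>" "\<sigma> = \<rho> - {v}" using boundary_nonzeroD rD by blast
      then have "\<rho> = insert v \<sigma>" "v \<in> ?U"
        using rD by (auto simp: coface_vertices_def insert_absorb)
      then show False using r by auto
    qed
    then show "boundary (k + 1) \<sigma> \<rho> * boundary (k + 1) \<sigma> \<rho> = 0" by simp
  qed (use cof in auto)
  also have "\<dots> = (\<Sum>w\<in>?U. boundary (k + 1) \<sigma> (insert w \<sigma>) * boundary (k + 1) \<sigma> (insert w \<sigma>))"
    by (subst sum.reindex) (auto simp: inj_on_def coface_vertices_def)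
  also have "\<dots> = (\<Sum>w\<in>?U. 1)"
  proof (rule sum.cong)
    fix w assume w: "w \<in> ?U"
    have "boundary (k + 1) (insert w \<sigma> - {w}) (insert w \<sigma>) = face_sign (insert w \<sigma>) w"
      using cof[OF w] simplicesD[OF sc cof[OF w]] by (intro boundary_remove) auto
    then show "boundary (k + 1) \<sigma> (insert w \<sigma>) * boundary (k + 1) \<sigma> (insert w \<sigma>) = 1"
      using w by (simp add: coface_vertices_def)
  qed simp
  finally show ?thesis using 1 by (simp add: laplacian_def)
qed

text \<open>A nonzero term requires a common face or a common coface, and in either case the two
  distinct simplices differ by one exchanged vertex.\<close>

lemma laplacian_nonzero_exchange:
  assumes sc: "is_simplicial_complex n \<Gamma>" and s: "\<sigma> \<in> simplices \<Gamma> k" and t: "\<tau> \<in> simplices \<Gamma> k"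
    and "\<tau> \<noteq> \<sigma>" and nz: "laplacian \<Gamma> k \<tau> \<sigma> \<noteq> 0"
  shows "\<exists>v\<in>\<sigma>. \<exists>w\<in>\<tau> - \<sigma>. \<tau> = insert w (\<sigma> - {v})"
proof -
  note sD = simplicesD[OF sc s] and tD = simplicesD[OF sc t]
  consider "(\<Sum>\<rho>\<in>simplices \<Gamma> (k - 1). boundary k \<rho> \<tau> * boundary k \<rho> \<sigma>) \<noteq> 0"
    | "(\<Sum>\<rho>\<in>simplices \<Gamma> (k + 1). boundary (k + 1) \<tau> \<rho> * boundary (k + 1) \<sigma> \<rho>) \<noteq> 0"
    using nz unfolding laplacian_def by fastforce
  then show ?thesis
  proof cases
    case 1
    then obtain \<rho> where "boundary k \<rho> \<tau> \<noteq> 0" "boundary k \<rho> \<sigma> \<noteq> 0"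
      by (auto elim!: sum.not_neutral_contains_not_neutral)
    then obtain v w where "v \<in> \<sigma>" "\<rho> = \<sigma> - {v}" "w \<in> \<tau>" "\<rho> = \<tau> - {w}"
      using boundary_nonzeroD sD tD by meson
    moreover from this have "w \<notin> \<sigma>" using \<open>\<tau> \<noteq> \<sigma>\<close> by blast
    ultimately show ?thesis by blast
  next
    case 2
    then obtain \<rho> where r: "\<rho> \<in> simplices \<Gamma> (k + 1)" and "boundary (k + 1) \<tau> \<rho> \<noteq> 0" "boundary (k + 1) \<sigma> \<rho> \<noteq> 0"
      by (auto elim!: sum.not_neutral_contains_not_neutral)
    then obtain v w where "v \<in> \<rho>" "\<tau> = \<rho> - {v}" "w \<in> \<rho>" "\<sigma> = \<rho> - {w}"
      using boundary_nonzeroD simplicesD[OF sc r] by meson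
    moreover from this have "v \<noteq> w" using \<open>\<tau> \<noteq> \<sigma>\<close> by blast
    ultimately show ?thesis by blast
  qed
qed

text \<open>The two simplices share exactly one face, \<open>\<sigma> - {v}\<close>, and at most one
  coface, \<open>insert w \<sigma>\<close>. Each contributes a sign, and by
  \<open>face_sign_anticomm\<close> the signs are opposite, so they cancel when the coface is
  present.\<close>

lemma laplacian_exchange:
  assumes sc: "is_simplicial_complex n \<Gamma>" and s: "\<sigma> \<in> simplices \<Gamma> k" and "k > 0"
    and v: "v \<in> \<sigma>" and w: "w \<notin> \<sigma>" and t: "insert w (\<sigma> - {v}) \<in> simplices \<Gamma> k"
  shows "\<bar>laplacian \<Gamma> k (insert w (\<sigma> - {v})) \<sigma>\<bar> = (if insert w \<sigma> \<in> \<Gamma> then 0 else 1)"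
proof -
  let ?t = "insert w (\<sigma> - {v})" and ?r = "insert w \<sigma>"
  note sD = simplicesD[OF sc s] and tD = simplicesD[OF sc t]
  have vw: "v \<noteq> w" using v w by auto
  have faces: "?t - {w} = \<sigma> - {v}" "?r - {w} = \<sigma>" "?r - {v} = ?t" using v w vw by auto
  have down: "(\<Sum>\<rho>\<in>simplices \<Gamma> (k - 1). boundary k \<rho> ?t * boundary k \<rho> \<sigma>) = face_sign ?t w * face_sign \<sigma> v"
  proof -
    have "(\<Sum>\<rho>\<in>simplices \<Gamma> (k - 1). boundary k \<rho> ?t * boundary k \<rho> \<sigma>) =
      (\<Sum>\<rho>\<in>{\<sigma> - {v}}. boundary k \<rho> ?t * boundary k \<rho> \<sigma>)"
    proof (intro sum.mono_neutral_right finite_simplices[OF sc] ballI)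
      fix \<rho> assume r: "\<rho> \<in> simplices \<Gamma> (k - 1) - {\<sigma> - {v}}"
      show "boundary k \<rho> ?t * boundary k \<rho> \<sigma> = 0"
      proof (rule ccontr)
        assume "boundary k \<rho> ?t * boundary k \<rho> \<sigma> \<noteq> 0"
        then have "boundary k \<rho> \<sigma> \<noteq> 0" "boundary k \<rho> ?t \<noteq> 0" by simp_all
        then obtain a b where "a \<in> \<sigma>" "\<rho> = \<sigma> - {a}" "b \<in> ?t" "\<rho> = ?t - {b}"
          using boundary_nonzeroD[OF _ sD(1,2)] boundary_nonzeroD[OF _ tD(1,2)] by meson
        then have "\<rho> = \<sigma> - {v}" using v w by blast
        then show False using r by simp
      qed
    qed (use face_in_simplices[OF sc s \<open>k > 0\<close> v] in auto)
    also have "\<dots> = face_sign ?t w * face_sign \<sigma> v"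
      using boundary_remove[OF sD(1,2) v] boundary_remove[OF tD(1,2), of w] by (simp add: faces)
    finally show ?thesis .
  qed
  have up: "(\<Sum>\<rho>\<in>simplices \<Gamma> (k + 1). boundary (k + 1) ?t \<rho> * boundary (k + 1) \<sigma> \<rho>) =
    (if ?r \<in> \<Gamma> then face_sign ?r v * face_sign ?r w else 0)"
  proof -
    \<comment> \<open>\<open>{?r} \<inter> \<Gamma>\<close> is a singleton or empty, which treats
      both cases of the result at once.\<close>
    have "(\<Sum>\<rho>\<in>simplices \<Gamma> (k + 1). boundary (k + 1) ?t \<rho> * boundary (k + 1) \<sigma> \<rho>) =
      (\<Sum>\<rho>\<in>{?r} \<inter> \<Gamma>. boundary (k + 1) ?t \<rho> * boundary (k + 1) \<sigma> \<rho>)"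
    proof (intro sum.mono_neutral_right finite_simplices[OF sc] ballI)
      fix \<rho> assume r: "\<rho> \<in> simplices \<Gamma> (k + 1) - {?r} \<inter> \<Gamma>"
      then have rs: "\<rho> \<in> simplices \<Gamma> (k + 1)" by simp
      note rD = simplicesD[OF sc rs]
      show "boundary (k + 1) ?t \<rho> * boundary (k + 1) \<sigma> \<rho> = 0"
      proof (rule ccontr)
        assume "boundary (k + 1) ?t \<rho> * boundary (k + 1) \<sigma> \<rho> \<noteq> 0"
        then have "boundary (k + 1) \<sigma> \<rho> \<noteq> 0" "boundary (k + 1) ?t \<rho> \<noteq> 0" by simp_all
        then obtain a b where "a \<in> \<rho>" "\<sigma> = \<rho> - {a}" "b \<in> \<rho>" "?t = \<rho> - {b}"
          using boundary_nonzeroD[OF _ rD(1,2)] by meson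
        then have "\<rho> = ?r" using v w by blast
        then show False using r rD(4) by simp
      qed
    qed (use sD w in \<open>auto simp: simplices_def\<close>)
    also have "\<dots> = (if ?r \<in> \<Gamma> then face_sign ?r v * face_sign ?r w else 0)"
      using boundary_remove[of ?r "k + 1" v] boundary_remove[of ?r "k + 1" w] sD v w by (simp add: faces)
    finally show ?thesis .
  qed
  show ?thesis
    using face_sign_anticomm[of ?r v w] sD(1) v vw
    unfolding laplacian_def up down by (simp add: faces abs_mult)
qed

text \<open>\<open>W\<close> consists of the vertices outside \<open>\<sigma>\<close> that do not
  extend it to a simplex. The diagonal entry of the Laplacian is \<open>n - card W\<close>, so that
  of \<open>H\<close> is \<open>card W / n\<close>; every nonzero off-diagonal entry of
  \<open>H\<close> has absolute value \<open>1 / n\<close> and arises from a pair in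
  \<open>R\<close>.\<close>

lemma Hnorm_le_exchanges:
  fixes R :: "(nat \<times> nat) set"
  assumes sc: "is_simplicial_complex n \<Gamma>" and s: "\<sigma> \<in> simplices \<Gamma> k" and "k > 0"
  defines "W \<equiv> {1..n} - \<sigma> - coface_vertices n \<Gamma> \<sigma>"
  defines "R \<equiv> {(v, w). v \<in> \<sigma> \<and> w \<in> W \<and> insert w (\<sigma> - {v}) \<in> \<Gamma>}"
  shows "Hnorm n \<Gamma> k \<sigma> \<le> (real (card W) + real (card R)) / real n"
    and "k + 1 + card (coface_vertices n \<Gamma> \<sigma>) + card W = n"
proof -
  note sD = simplicesD[OF sc s]
  let ?S = "simplices \<Gamma> k" and ?U = "coface_vertices n \<Gamma> \<sigma>"
  have U: "?U \<subseteq> {1..n} - \<sigma>" by (auto simp: coface_vertices_def)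
  have "card W = card ({1..n} - \<sigma>) - card ?U"
    unfolding W_def using U by (intro card_Diff_subset) (auto intro: finite_subset)
  moreover have "card ?U \<le> card ({1..n} - \<sigma>)" using U by (intro card_mono) auto
  moreover have "card ({1..n} - \<sigma>) = n - (k + 1)" using sD by (simp add: card_Diff_subset)
  moreover have "k + 1 \<le> n" using sD card_mono[of "{1..n}" \<sigma>] by simp
  ultimately show n: "k + 1 + card ?U + card W = n" by linarith
  then have "n > 0" by linarith
  let ?T = "{\<tau> \<in> ?S - {\<sigma>}. laplacian \<Gamma> k \<tau> \<sigma> \<noteq> 0}"
  have finR: "finite R"
    by (rule finite_subset[of _ "\<sigma> \<times> W"]) (auto simp: R_def W_def sD)
  have T: "?T \<subseteq> (\<lambda>(v, w). insert w (\<sigma> - {v})) ` R"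
    and T1: "\<And>\<tau>. \<tau> \<in> ?T \<Longrightarrow> \<bar>laplacian \<Gamma> k \<tau> \<sigma>\<bar> = 1"
  proof -
    have "\<tau> \<in> (\<lambda>(v, w). insert w (\<sigma> - {v})) ` R \<and> \<bar>laplacian \<Gamma> k \<tau> \<sigma>\<bar> = 1" if "\<tau> \<in> ?T" for \<tau>
    proof -
      have t: "\<tau> \<in> ?S" "\<tau> \<noteq> \<sigma>" "laplacian \<Gamma> k \<tau> \<sigma> \<noteq> 0" using that by auto
      note tD = simplicesD[OF sc t(1)]
      obtain v w where vw: "v \<in> \<sigma>" "w \<in> \<tau> - \<sigma>" "\<tau> = insert w (\<sigma> - {v})"
        using laplacian_nonzero_exchange[OF sc s t] by blast
      have "\<bar>laplacian \<Gamma> k \<tau> \<sigma>\<bar> = (if insert w \<sigma> \<in> \<Gamma> then 0 else 1)"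
        using laplacian_exchange[OF sc s \<open>k > 0\<close>, of v w] vw t(1) by simp
      then have "insert w \<sigma> \<notin> \<Gamma>" "\<bar>laplacian \<Gamma> k \<tau> \<sigma>\<bar> = 1" using t(3) by (auto split: if_splits)
      moreover from this have "(v, w) \<in> R"
        using vw tD by (auto simp: R_def W_def coface_vertices_def)
      ultimately show ?thesis using vw(3) by force
    qed
    then show "?T \<subseteq> (\<lambda>(v, w). insert w (\<sigma> - {v})) ` R"
      and "\<And>\<tau>. \<tau> \<in> ?T \<Longrightarrow> \<bar>laplacian \<Gamma> k \<tau> \<sigma>\<bar> = 1" by auto
  qed
  have cardT: "card ?T \<le> card R"
    using card_mono[OF finite_imageI[OF finR] T] card_image_le[OF finR] by (rule le_trans)
  have "(\<Sum>\<tau>\<in>?S - {\<sigma>}. \<bar>Hmat n \<Gamma> k \<tau> \<sigma>\<bar>) = (\<Sum>\<tau>\<in>?T. \<bar>Hmat n \<Gamma> k \<tau> \<sigma>\<bar>)"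
    by (rule sum.mono_neutral_right) (auto simp: finite_simplices[OF sc] Hmat_def)
  also have "\<dots> = (\<Sum>\<tau>\<in>?T. 1 / real n)"
    using T1 by (intro sum.cong) (auto simp: Hmat_def)
  also have "\<dots> \<le> real (card R) / real n"
    using cardT by (simp add: divide_right_mono)
  finally have off: "(\<Sum>\<tau>\<in>?S - {\<sigma>}. \<bar>Hmat n \<Gamma> k \<tau> \<sigma>\<bar>) \<le> real (card R) / real n" .
  have "Hmat n \<Gamma> k \<sigma> \<sigma> = (real n - laplacian \<Gamma> k \<sigma> \<sigma>) / real n"
    using \<open>n > 0\<close> by (simp add: Hmat_def diff_divide_distrib)
  also have "\<dots> = real (card W) / real n"
    using n unfolding laplacian_diag[OF sc s \<open>k > 0\<close>] by (intro arg_cong2[where f = "(/)"]) linarith+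
  finally have "\<bar>Hmat n \<Gamma> k \<sigma> \<sigma>\<bar> = real (card W) / real n" by simp
  moreover have "Hnorm n \<Gamma> k \<sigma> = \<bar>Hmat n \<Gamma> k \<sigma> \<sigma>\<bar> + (\<Sum>\<tau>\<in>?S - {\<sigma>}. \<bar>Hmat n \<Gamma> k \<tau> \<sigma>\<bar>)"
    unfolding Hnorm_def by (rule sum.remove[OF finite_simplices[OF sc] s])
  ultimately show "Hnorm n \<Gamma> k \<sigma> \<le> (real (card W) + real (card R)) / real n"
    using off by (simp add: add_divide_distrib)
qed

lemma Hnorm_le_n:
  assumes sc: "is_simplicial_complex n \<Gamma>" and s: "\<sigma> \<in> simplices \<Gamma> k" and "k > 0"
  shows "Hnorm n \<Gamma> k \<sigma> \<le> real n"
proof -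
  note sD = simplicesD[OF sc s]
  let ?W = "{1..n} - \<sigma> - coface_vertices n \<Gamma> \<sigma>"
  let ?R = "{(v, w). v \<in> \<sigma> \<and> w \<in> ?W \<and> insert w (\<sigma> - {v}) \<in> \<Gamma>}"
  note b = Hnorm_le_exchanges[OF assms]
  have "card ?R \<le> card (\<sigma> \<times> ?W)" using sD by (intro card_mono) auto
  then have "card ?W + card ?R \<le> (k + 2) * card ?W" using sD by (simp add: card_cartesian_product)
  \<comment> \<open>A nonempty \<open>?W\<close> gives \<open>k + 2 \<le> n\<close> by the count
    \<open>b(2)\<close>. For an empty one \<open>k + 1 = n\<close> is possible, but the left side is
    0.\<close>
  also have "\<dots> \<le> n * n"
  proof (cases "card ?W = 0")
    case False
    then show ?thesis using b(2) by (intro mult_mono) linarith+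
  next
    case True
    then show ?thesis by (simp only: mult_0_right le0)
  qed
  finally have "real (card ?W + card ?R) \<le> real (n * n)"
    by (simp only: of_nat_le_iff)
  then have "real (card ?W) + real (card ?R) \<le> real n * real n"
    by (simp only: of_nat_add of_nat_mult)
  moreover have "n > 0" using b(2) by linarith
  ultimately have "(real (card ?W) + real (card ?R)) / real n \<le> real n"
    by (simp add: divide_le_eq)
  then show ?thesis using b(1) by linarith
qed

text \<open>If exchanging \<open>v\<close> for \<open>w\<close> gives a clique but adding \<open>w\<close> does not, then \<open>v\<close> is the only vertex of
  \<open>\<sigma>\<close> not adjacent to \<open>w\<close>; so \<open>w\<close> determines \<open>v\<close>.\<close>

lemma Hnorm_le_2:
  assumes sc: "is_simplicial_complex n \<Gamma>" and s: "\<sigma> \<in> simplices \<Gamma> k" and "k > 0"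
    and "is_clique_complex n \<Gamma>"
  shows "Hnorm n \<Gamma> k \<sigma> \<le> 2"
proof -
  note sD = simplicesD[OF sc s]
  let ?W = "{1..n} - \<sigma> - coface_vertices n \<Gamma> \<sigma>"
  let ?R = "{(v, w). v \<in> \<sigma> \<and> w \<in> ?W \<and> insert w (\<sigma> - {v}) \<in> \<Gamma>}"
  note b = Hnorm_le_exchanges[OF assms(1-3)]
  obtain E where G: "\<Gamma> = {\<sigma>. \<sigma> \<subseteq> {1..n} \<and> (\<forall>x\<in>\<sigma>. \<forall>y\<in>\<sigma>. x \<noteq> y \<longrightarrow> {x, y} \<in> E)}"
    using assms(4) by (auto simp: is_clique_complex_def)
  have unique: "v = v'"
    if "(v, w) \<in> ?R" "(v', w) \<in> ?R" for v v' w
  proof (rule ccontr)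
    assume "v \<noteq> v'"
    have w: "w \<in> {1..n}" "w \<notin> \<sigma>" using that by auto
    \<comment> \<open>Since \<open>v \<noteq> v'\<close>, every \<open>x \<in> \<sigma>\<close> lies
      together with \<open>w\<close> in at least one of the two exchanged cliques.\<close>
    have "{x, w} \<in> E" if "x \<in> \<sigma>" for x
      using \<open>(v, w) \<in> ?R\<close> \<open>(v', w) \<in> ?R\<close> \<open>v \<noteq> v'\<close> that w unfolding G by (cases "x = v") auto
    then have "insert w \<sigma> \<in> \<Gamma>" using sD(4) w unfolding G by (auto simp: insert_commute)
    then show False using that by (auto simp: coface_vertices_def)
  qed
  have "card ?R \<le> card ?W"
  proof (rule card_inj_on_le[of snd])
    show "inj_on snd ?R"
    proof (rule inj_onI)
      fix p q assume "p \<in> ?R" "q \<in> ?R" "snd p = snd q"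
      moreover from this obtain v v' w where "p = (v, w)" "q = (v', w)" by (cases p, cases q) simp
      ultimately show "p = q" using unique by blast
    qed
  qed auto
  then have "real (card ?W) + real (card ?R) \<le> 2 * real n" using b(2) by linarith
  moreover have "n > 0" using b(2) by linarith
  ultimately have "(real (card ?W) + real (card ?R)) / real n \<le> 2"
    by (simp add: divide_le_eq)
  then show ?thesis using b(1) by linarith
qed

lemma Hnorm_le_Cconst:
  assumes "is_simplicial_complex n \<Gamma>" and "\<sigma> \<in> simplices \<Gamma> k" and "k > 0"
  shows "Hnorm n \<Gamma> k \<sigma> \<le> Cconst n \<Gamma>"
  using Hnorm_le_n[OF assms] Hnorm_le_2[OF assms] by (simp add: Cconst_def)

section \<open>The procedure CBNE-Var\<close>

text \<open>The number of paths is fixed by the variance estimate alone, so questions about sample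
  counts reduce to \<open>V_hat\<close>.\<close>

lemma map_snd_CBNE_Var:
  "map_pmf snd (CBNE_Var n \<Gamma> k l \<epsilon> \<eta>) = map_pmf (N_p n \<Gamma> l \<epsilon> \<eta>) (V_hat n \<Gamma> k l \<epsilon> \<eta>)"
  by (simp add: CBNE_Var_def map_bind_pmf map_pmf_comp map_pmf_const map_pmf_def[of "N_p n \<Gamma> l \<epsilon> \<eta>"])

lemma map_fst_CBNE_Var:
  "map_pmf fst (CBNE_Var n \<Gamma> k l \<epsilon> \<eta>) = bind_pmf (V_hat n \<Gamma> k l \<epsilon> \<eta>) (\<lambda>V.
     sample_mean (nat \<lceil>N_p n \<Gamma> l \<epsilon> \<eta> V\<rceil>) (random_path n \<Gamma> k l) (path_value n \<Gamma> k l))"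
  by (simp add: CBNE_Var_def map_bind_pmf map_pmf_comp)

lemma expectation_CBNE_Var_samples:
  fixes F :: "real \<Rightarrow> real"
  shows "measure_pmf.expectation (CBNE_Var n \<Gamma> k l \<epsilon> \<eta>) (\<lambda>(m, Np). F Np) =
    measure_pmf.expectation (V_hat n \<Gamma> k l \<epsilon> \<eta>) (\<lambda>V. F (N_p n \<Gamma> l \<epsilon> \<eta> V))"
proof -
  have "measure_pmf.expectation (CBNE_Var n \<Gamma> k l \<epsilon> \<eta>) (\<lambda>(m, Np). F Np) =
    measure_pmf.expectation (map_pmf snd (CBNE_Var n \<Gamma> k l \<epsilon> \<eta>)) F"
    by (simp add: case_prod_unfold)
  then show ?thesis by (simp only: map_snd_CBNE_Var integral_map_pmf)
qed

lemma prob_CBNE_Var_samples: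
  "measure_pmf.prob (CBNE_Var n \<Gamma> k l \<epsilon> \<eta>) {(m, Np). Q Np} =
    measure_pmf.prob (V_hat n \<Gamma> k l \<epsilon> \<eta>) {V. Q (N_p n \<Gamma> l \<epsilon> \<eta> V)}"
proof -
  have "measure_pmf.prob (CBNE_Var n \<Gamma> k l \<epsilon> \<eta>) {(m, Np). Q Np} =
    measure_pmf.prob (map_pmf snd (CBNE_Var n \<Gamma> k l \<epsilon> \<eta>)) {Np. Q Np}"
    by (simp add: case_prod_unfold vimage_def)
  then show ?thesis by (simp only: map_snd_CBNE_Var measure_map_pmf) (simp add: vimage_def)
qed

lemma uses_at_most_samples_mono:
  assumes "uses_at_most_samples n \<Gamma> k l \<epsilon> \<eta> B" and "B \<le> B'"
  shows "uses_at_most_samples n \<Gamma> k l \<epsilon> \<eta> B'"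
proof -
  have "measure_pmf.prob (CBNE_Var n \<Gamma> k l \<epsilon> \<eta>) {(m, Np). N_s n \<Gamma> l \<epsilon> \<eta> + Np \<le> B} \<le>
    measure_pmf.prob (CBNE_Var n \<Gamma> k l \<epsilon> \<eta>) {(m, Np). N_s n \<Gamma> l \<epsilon> \<eta> + Np \<le> B'}"
    using assms(2) by (intro measure_pmf.finite_measure_mono) auto
  then show ?thesis using assms unfolding uses_at_most_samples_def by linarith
qed

section \<open>Size of the constants and moments of the variance estimate\<close>

lemma N_s_pos:
  assumes "Cconst n \<Gamma> > 0" "\<epsilon> > 0" "\<eta> > 0"
  shows "N_s n \<Gamma> l \<epsilon> \<eta> > 0"
  using assms by (simp add: N_s_def)

text \<open>The exponents in \<open>N_s\<close> are chosen to balance the two costs: \<open>N_s\<close> itself and the contribution of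
  the safety margin \<open>C\<^sup>2\<^sup>l / sqrt N_s\<close> to \<open>N_p\<close>.\<close>

lemma N_s_balance:
  assumes "Cconst n \<Gamma> > 0" "\<epsilon> > 0" "\<eta> > 0"
  shows "Cconst n \<Gamma> ^ (2 * l) / sqrt (N_s n \<Gamma> l \<epsilon> \<eta>) = N_s n \<Gamma> l \<epsilon> \<eta> * (\<eta> * \<epsilon>\<^sup>2)"
proof -
  let ?C = "Cconst n \<Gamma>" and ?N = "N_s n \<Gamma> l \<epsilon> \<eta>"
  have N: "?N > 0" using assms by (rule N_s_pos)
  \<comment> \<open>The factor \<open>sqrt ?N\<close> scales every exponent in \<open>N_s\<close> by
    3/2: \<open>4l/3\<close>, \<open>-4/3\<close>, \<open>-2/3\<close> become \<open>2l\<close>,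
    \<open>-2\<close>, \<open>-1\<close>.\<close>
  have "?N * sqrt ?N = ?N powr (1 + 1 / 2)"
    using N by (simp only: powr_add powr_one powr_half_sqrt less_imp_le)
  also have "\<dots> = ?C powr (2 * real l) * \<epsilon> powr (- 2) * \<eta> powr (- 1)"
    using assms by (simp add: N_s_def powr_mult powr_powr)
  also have "\<dots> = ?C ^ (2 * l) / (\<eta> * \<epsilon>\<^sup>2)"
    using assms powr_realpow[of ?C "2 * l"] powr_realpow[of \<epsilon> 2]
    by (simp add: powr_minus_divide)
  finally show ?thesis using N assms by (simp add: field_simps)
qed

text \<open>A \<open>k\<close>-simplex with \<open>k > 0\<close> has at least two vertices, so
  \<open>n \<ge> 2\<close>; this gives the upper bound also for clique complexes, where the constant
  is 2.\<close>

lemma Cconst_bounds: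
  assumes sc: "is_simplicial_complex n \<Gamma>" and "k > 0" and ne: "simplices \<Gamma> k \<noteq> {}"
  shows "0 < Cconst n \<Gamma>" "Cconst n \<Gamma> \<le> real n"
proof -
  obtain \<sigma> where "\<sigma> \<in> simplices \<Gamma> k" using ne by blast
  from simplicesD[OF sc this] have "k + 1 \<le> n" using card_mono[of "{1..n}" \<sigma>] by simp
  then show "0 < Cconst n \<Gamma>" "Cconst n \<Gamma> \<le> real n" using \<open>k > 0\<close> by (auto simp: Cconst_def)
qed

text \<open>\<open>variance_le_bounded\<close> applies with \<open>M\<close> because the column
  norms are at most \<open>Cconst n \<Gamma>\<close>. Rounding the number of samples up only lowers
  the variance, so the bound can be stated with \<open>N\<close> itself.\<close>

lemma V_hat_moments:
  fixes n k l :: nat and \<Gamma> :: "nat set set" and \<epsilon> \<eta> :: real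
  assumes sc: "is_simplicial_complex n \<Gamma>" and k: "k > 0" and ne: "simplices \<Gamma> k \<noteq> {}"
    and pos: "\<epsilon> > 0" "\<eta> > 0"
  defines "v \<equiv> 1 / real (card (simplices \<Gamma> k)) * (\<Sum>\<sigma>\<in>simplices \<Gamma> k. Hnorm n \<Gamma> k \<sigma> ^ (2 * l))"
    and "M \<equiv> Cconst n \<Gamma> ^ (2 * l)" and "N \<equiv> N_s n \<Gamma> l \<epsilon> \<eta>"
  shows "finite (set_pmf (V_hat n \<Gamma> k l \<epsilon> \<eta>))"
    and "\<And>x. x \<in> set_pmf (V_hat n \<Gamma> k l \<epsilon> \<eta>) \<Longrightarrow> x \<ge> 0"
    and "measure_pmf.expectation (V_hat n \<Gamma> k l \<epsilon> \<eta>) (\<lambda>x. x) = v"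
    and "measure_pmf.expectation (V_hat n \<Gamma> k l \<epsilon> \<eta>) (\<lambda>x. (x - v)\<^sup>2) \<le> v * (M - v) / N"
    and "0 \<le> v" and "v \<le> M"
proof -
  let ?S = "simplices \<Gamma> k" and ?h = "\<lambda>\<sigma>. Hnorm n \<Gamma> k \<sigma> ^ (2 * l)"
  let ?X = "pmf_of_set ?S"
  have fin: "finite ?S" using sc by (rule finite_simplices)
  have h: "0 \<le> ?h \<sigma> \<and> ?h \<sigma> \<le> M" if "\<sigma> \<in> ?S" for \<sigma>
    using Hnorm_nonneg[of n \<Gamma> k \<sigma>] Hnorm_le_Cconst[OF sc that k]
    unfolding M_def by (auto intro: power_mono)
  have finX: "finite (set_pmf ?X)" using fin ne by simp
  have v: "measure_pmf.expectation ?X ?h = v"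
    using fin ne by (simp add: integral_pmf_of_set v_def)
  have "N > 0" unfolding N_def using N_s_pos[OF Cconst_bounds(1)[OF sc k ne] pos] .
  then have K: "nat \<lceil>N\<rceil> > 0" "real (nat \<lceil>N\<rceil>) \<ge> N" by (auto simp: real_nat_ceiling_ge)
  show "finite (set_pmf (V_hat n \<Gamma> k l \<epsilon> \<eta>))"
    unfolding V_hat_def using finX by (rule finite_set_sample_mean)
  show "\<And>x. x \<in> set_pmf (V_hat n \<Gamma> k l \<epsilon> \<eta>) \<Longrightarrow> x \<ge> 0"
    by (auto simp: V_hat_def sample_mean_def Hnorm_nonneg intro!: sum_nonneg divide_nonneg_nonneg)
  show "measure_pmf.expectation (V_hat n \<Gamma> k l \<epsilon> \<eta>) (\<lambda>x. x) = v"
    using expectation_sample_mean[OF finX K(1), of ?h] v by (simp add: V_hat_def N_def)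
  have "measure_pmf.expectation ?X ?h \<le> measure_pmf.expectation ?X (\<lambda>_. M)"
    using h fin ne by (intro integral_mono_AE integrable_measure_pmf_finite finX) (auto simp: AE_measure_pmf_iff)
  then show vM: "v \<le> M" using v by simp
  show v0: "0 \<le> v" unfolding v[symmetric] by (simp add: Hnorm_nonneg)
  have "measure_pmf.expectation (V_hat n \<Gamma> k l \<epsilon> \<eta>) (\<lambda>x. (x - v)\<^sup>2) =
    measure_pmf.variance ?X ?h / real (nat \<lceil>N\<rceil>)"
    using variance_sample_mean[OF finX K(1), of ?h] v by (simp add: V_hat_def N_def)
  also have "\<dots> \<le> v * (M - v) / real (nat \<lceil>N\<rceil>)"
    using variance_le_bounded[OF finX, of ?h M] h fin ne v by (intro divide_right_mono) auto
  also have "\<dots> \<le> v * (M - v) / N"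
    using v0 vM K(2) \<open>N > 0\<close> by (intro divide_left_mono) auto
  finally show "measure_pmf.expectation (V_hat n \<Gamma> k l \<epsilon> \<eta>) (\<lambda>x. (x - v)\<^sup>2) \<le> v * (M - v) / N" .
qed

text \<open>For given \<open>V\<close> Chebyshev's inequality yields a non-strict bound; the strict
  inequality in \<open>is_estimate\<close> comes from
  \<open>expectation_inverse_shifted_less_1\<close>.\<close>

lemma CBNE_Var_is_estimate:
  assumes sc: "is_simplicial_complex n \<Gamma>" and k: "k > 0" and ne: "simplices \<Gamma> k \<noteq> {}"
    and l: "l \<ge> 1" and pos: "\<epsilon> > 0" "\<eta> > 0"
  shows "is_estimate (map_pmf fst (CBNE_Var n \<Gamma> k l \<epsilon> \<eta>)) \<epsilon> \<eta>
    (1 / real (card (simplices \<Gamma> k)) *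
      mat_trace (simplices \<Gamma> k) (mat_power (simplices \<Gamma> k) (Hmat n \<Gamma> k) l))"
proof -
  define v where "v = 1 / real (card (simplices \<Gamma> k)) * (\<Sum>\<sigma>\<in>simplices \<Gamma> k. Hnorm n \<Gamma> k \<sigma> ^ (2 * l))"
  define M where "M = Cconst n \<Gamma> ^ (2 * l)"
  define N where "N = N_s n \<Gamma> l \<epsilon> \<eta>"
  define s where "s = M / sqrt N"
  let ?V = "V_hat n \<Gamma> k l \<epsilon> \<eta>" and ?P = "random_path n \<Gamma> k l" and ?f = "path_value n \<Gamma> k l"
  let ?Np = "N_p n \<Gamma> l \<epsilon> \<eta>"
  note V = V_hat_moments[OF sc k ne pos, where l = l, folded v_def M_def N_def]
  have C: "Cconst n \<Gamma> > 0" using Cconst_bounds[OF sc k ne] by simp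
  have N: "N > 0" unfolding N_def using C pos by (rule N_s_pos)
  have M: "M > 0" using C by (simp add: M_def)
  have s: "s > 0" using N M by (simp add: s_def)
  have s2: "s\<^sup>2 = M\<^sup>2 / N" using N by (simp add: s_def power_divide)
  have Np: "?Np x = (x + s) / (\<eta> * \<epsilon>\<^sup>2)" for x
    by (simp add: N_p_def s_def M_def N_def)
  define \<mu> where "\<mu> = measure_pmf.expectation ?P ?f"
  have finP: "finite (set_pmf ?P)" using sc ne by (rule finite_set_random_path)
  have "measure_pmf.variance ?P ?f \<le> measure_pmf.expectation ?P (\<lambda>p. (?f p)\<^sup>2)"
    by (simp add: measure_pmf.variance_eq integrable_measure_pmf_finite[OF finP])
  also have "\<dots> \<le> v" unfolding v_def using sc ne l by (rule second_moment_path_value)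
  finally have var: "measure_pmf.variance ?P ?f \<le> v" .
  have fail: "measure_pmf.prob (sample_mean (nat \<lceil>?Np x\<rceil>) ?P ?f) {y. \<bar>y - \<mu>\<bar> > \<epsilon>} \<le> \<eta> * (v / (x + s))"
    if "x \<ge> 0" for x
  proof -
    let ?K = "nat \<lceil>?Np x\<rceil>"
    have Npos: "?Np x > 0" using that s pos by (simp add: Np)
    then have K: "?K > 0" "real ?K \<ge> ?Np x" by (auto simp: real_nat_ceiling_ge)
    have "measure_pmf.prob (sample_mean ?K ?P ?f) {y. \<bar>y - \<mu>\<bar> > \<epsilon>} \<le>
      measure_pmf.prob (sample_mean ?K ?P ?f) {y. \<bar>y - \<mu>\<bar> \<ge> \<epsilon>}"
      by (intro measure_pmf.finite_measure_mono) auto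
    also have "\<dots> \<le> measure_pmf.variance ?P ?f / (real ?K * \<epsilon>\<^sup>2)"
      unfolding \<mu>_def using finP K(1) pos(1) by (rule prob_sample_mean_deviation)
    also have "\<dots> \<le> v / (real ?K * \<epsilon>\<^sup>2)"
      using var by (intro divide_right_mono) auto
    also have "\<dots> \<le> v / (?Np x * \<epsilon>\<^sup>2)"
      using K Npos pos V(5) by (intro divide_left_mono mult_right_mono) auto
    also have "\<dots> = \<eta> * (v / (x + s))"
      using pos that s by (simp add: Np)
    finally show ?thesis .
  qed
  have "measure_pmf.prob (map_pmf fst (CBNE_Var n \<Gamma> k l \<epsilon> \<eta>)) {y. \<bar>y - \<mu>\<bar> > \<epsilon>} =
    measure_pmf.expectation ?V (\<lambda>x. measure_pmf.prob (sample_mean (nat \<lceil>?Np x\<rceil>) ?P ?f) {y. \<bar>y - \<mu>\<bar> > \<epsilon>})"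
    unfolding map_fst_CBNE_Var using V(1) finP by (intro prob_bind_finite finite_set_sample_mean)
  also have "\<dots> \<le> measure_pmf.expectation ?V (\<lambda>x. \<eta> * (v / (x + s)))"
    by (intro integral_mono_AE integrable_measure_pmf_finite V(1) AE_pmfI fail V(2))
  also have "\<dots> = \<eta> * measure_pmf.expectation ?V (\<lambda>x. v / (x + s))"
    by (rule integral_mult_right_zero)
  also have "\<dots> < \<eta> * 1"
  proof (rule mult_strict_left_mono[OF _ pos(2)])
    \<comment> \<open>Relaxing \<open>M - v\<close> to \<open>M\<close> brings the variance bound
      into the form \<open>v * s\<^sup>2 / M\<close>, because
      \<open>s\<^sup>2 = M\<^sup>2 / N\<close>.\<close>
    have "v * (M - v) / N \<le> v * M / N"
      using V(5,6) N by (intro divide_right_mono mult_left_mono) auto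
    also have "\<dots> = v * s\<^sup>2 / M" unfolding s2 using M by (simp add: power2_eq_square)
    finally have "measure_pmf.expectation ?V (\<lambda>x. (x - v)\<^sup>2) \<le> v * s\<^sup>2 / M" using V(4) by linarith
    then show "measure_pmf.expectation ?V (\<lambda>x. v / (x + s)) < 1"
      using V M s by (intro expectation_inverse_shifted_less_1[where M = M])
  qed
  finally show ?thesis
    unfolding is_estimate_def \<mu>_def expectation_path_value[OF sc ne] by simp
qed

text \<open>By \<open>N_s_balance\<close>, \<open>N_p\<close> equals \<open>c * V + N\<close>, so
  the total has mean \<open>2 * N + c * v\<close>. The third \<open>N\<close> in the bound absorbs
  the two roundings when \<open>N \<ge> 2\<close>, and in the probability clause it leaves room for
  \<open>V\<close> to exceed its mean by \<open>M / sqrt N\<close>.\<close>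

lemma CBNE_Var_uses_at_most:
  assumes sc: "is_simplicial_complex n \<Gamma>" and k: "k > 0" and ne: "simplices \<Gamma> k \<noteq> {}"
    and pos: "\<epsilon> > 0" "\<eta> > 0"
  shows "uses_at_most_samples n \<Gamma> k l \<epsilon> \<eta>
    (3 * N_s n \<Gamma> l \<epsilon> \<eta> + 1 / (\<eta> * \<epsilon>\<^sup>2) * (1 / real (card (simplices \<Gamma> k)) *
      (\<Sum>\<sigma>\<in>simplices \<Gamma> k. Hnorm n \<Gamma> k \<sigma> ^ (2 * l))))"
proof -
  define v where "v = 1 / real (card (simplices \<Gamma> k)) * (\<Sum>\<sigma>\<in>simplices \<Gamma> k. Hnorm n \<Gamma> k \<sigma> ^ (2 * l))"
  define M where "M = Cconst n \<Gamma> ^ (2 * l)"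
  define N where "N = N_s n \<Gamma> l \<epsilon> \<eta>"
  define c where "c = 1 / (\<eta> * \<epsilon>\<^sup>2)"
  define B where "B = 3 * N + c * v"
  let ?V = "V_hat n \<Gamma> k l \<epsilon> \<eta>" and ?Np = "N_p n \<Gamma> l \<epsilon> \<eta>"
  note V = V_hat_moments[OF sc k ne pos, where l = l, folded v_def M_def N_def]
  note int = integrable_measure_pmf_finite[OF V(1)]
  have C: "Cconst n \<Gamma> > 0" using Cconst_bounds[OF sc k ne] by simp
  have N: "N > 0" unfolding N_def using C pos by (rule N_s_pos)
  have M: "M > 0" using C by (simp add: M_def)
  have c: "c > 0" using pos by (simp add: c_def)
  have bal: "M / sqrt N = N / c"
    using N_s_balance[OF C pos, of l] by (simp add: M_def N_def c_def)
  have Np: "?Np x = c * x + N" for x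
  proof -
    have "?Np x = c * (x + M / sqrt N)" by (simp add: N_p_def M_def N_def c_def)
    then show ?thesis using c by (simp add: bal distrib_left)
  qed
  have mean: "measure_pmf.expectation ?V (\<lambda>x. a + ?Np x) = a + c * v + N" for a
    by (simp add: Np int V(3))
  have 1: "measure_pmf.expectation (CBNE_Var n \<Gamma> k l \<epsilon> \<eta>) (\<lambda>(m, Np). N + Np) \<le> B"
    unfolding expectation_CBNE_Var_samples mean using N by (simp add: B_def)
  have 2: "measure_pmf.expectation (CBNE_Var n \<Gamma> k l \<epsilon> \<eta>)
      (\<lambda>(m, Np). of_int \<lceil>N\<rceil> + of_int \<lceil>Np\<rceil>) \<le> B" if "N \<ge> 2"
  proof -
    have "measure_pmf.expectation ?V (\<lambda>x. of_int \<lceil>N\<rceil> + of_int \<lceil>?Np x\<rceil>) \<le>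
      measure_pmf.expectation ?V (\<lambda>x. (N + 2) + ?Np x)"
    proof (intro integral_mono int)
      fix x
      show "of_int \<lceil>N\<rceil> + of_int \<lceil>?Np x\<rceil> \<le> (N + 2) + ?Np x"
        using ceiling_correct[of N] ceiling_correct[of "?Np x"] by linarith
    qed
    then show ?thesis
      unfolding expectation_CBNE_Var_samples mean using that by (simp add: B_def)
  qed
  have 3: "measure_pmf.prob (CBNE_Var n \<Gamma> k l \<epsilon> \<eta>) {(m, Np). N + Np \<le> B} \<ge> 3 / 4"
  proof -
    let ?s = "M / sqrt N"
    have s: "?s > 0" "?s\<^sup>2 = M\<^sup>2 / N" using M N by (simp_all add: power_divide)
    \<comment> \<open>Exceeding \<open>B\<close> means that \<open>V\<close> exceeds its mean by
      more than \<open>N / c\<close>, which is \<open>?s\<close>.\<close>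
    have sub: "{x. \<not> N + ?Np x \<le> B} \<subseteq> {x. \<bar>x - v\<bar> \<ge> ?s}"
    proof safe
      fix x assume "\<not> N + ?Np x \<le> B"
      then have "c * (x - v) > N" by (simp add: Np B_def right_diff_distrib)
      then have "x - v > N / c" using c by (simp add: divide_less_eq mult.commute)
      then show "\<bar>x - v\<bar> \<ge> ?s" by (simp add: bal)
    qed
    have "measure_pmf.prob ?V {x. \<not> N + ?Np x \<le> B} \<le> measure_pmf.prob ?V {x. \<bar>x - v\<bar> \<ge> ?s}"
      using sub by (intro measure_pmf.finite_measure_mono) auto
    also have "\<dots> \<le> measure_pmf.expectation ?V (\<lambda>x. (x - v)\<^sup>2) / ?s\<^sup>2"
      using measure_pmf.Chebyshev_inequality[of "\<lambda>x. x" ?V ?s] s int[of power2] by (simp add: V(3))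
    also have "\<dots> \<le> (v * (M - v) / N) / ?s\<^sup>2"
      using V(4) by (intro divide_right_mono) auto
    also have "\<dots> = v * (M - v) / M\<^sup>2" using N by (simp add: s(2))
    \<comment> \<open>The constant is the maximum of \<open>t * (1 - t)\<close>, here with
      \<open>t = v / M\<close>.\<close>
    also have "\<dots> \<le> 1 / 4"
    proof -
      have "0 \<le> (M - 2 * v)\<^sup>2" by simp
      then have "4 * (v * (M - v)) \<le> M\<^sup>2" by (simp add: power2_eq_square algebra_simps)
      then show ?thesis using M by (simp add: divide_le_eq)
    qed
    finally have "measure_pmf.prob ?V {x. \<not> N + ?Np x \<le> B} \<le> 1 / 4" .
    moreover have "measure_pmf.prob ?V {x. N + ?Np x \<le> B} = 1 - measure_pmf.prob ?V {x. \<not> N + ?Np x \<le> B}"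
      using measure_pmf.prob_compl[of "{x. \<not> N + ?Np x \<le> B}" ?V] by (simp add: Compl_eq set_diff_eq)
    ultimately show ?thesis by (simp add: prob_CBNE_Var_samples)
  qed
  show ?thesis
    using 1 2 3 unfolding uses_at_most_samples_def B_def N_def c_def v_def by blast
qed

theorem theorem6:
  fixes n k l :: nat and \<Gamma> :: "nat set set" and \<epsilon> \<eta> :: real
  assumes "is_simplicial_complex n \<Gamma>"
    and "k > 0" and "simplices \<Gamma> k \<noteq> {}"
    and "l \<ge> 1" and "\<epsilon> > 0" and "\<eta> > 0"
  shows "is_estimate (map_pmf fst (CBNE_Var n \<Gamma> k l \<epsilon> \<eta>)) \<epsilon> \<eta>
           (1 / real (card (simplices \<Gamma> k)) *
            mat_trace (simplices \<Gamma> k) (mat_power (simplices \<Gamma> k) (Hmat n \<Gamma> k) l))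
       \<and> uses_at_most_samples n \<Gamma> k l \<epsilon> \<eta>
           (3 * real n powr (4 * real l / 3) / (\<eta> powr (2 / 3) * \<epsilon> powr (4 / 3)) +
            1 / (\<eta> * \<epsilon>\<^sup>2) * (1 / real (card (simplices \<Gamma> k)) *
              (\<Sum>\<sigma>\<in>simplices \<Gamma> k. Hnorm n \<Gamma> k \<sigma> ^ (2 * l))))
       \<and> (is_clique_complex n \<Gamma> \<longrightarrow>
           uses_at_most_samples n \<Gamma> k l \<epsilon> \<eta>
             (3 * 2 powr (4 * real l / 3) / (\<eta> powr (2 / 3) * \<epsilon> powr (4 / 3)) +
              1 / (\<eta> * \<epsilon>\<^sup>2) * (1 / real (card (simplices \<Gamma> k)) *
                (\<Sum>\<sigma>\<in>simplices \<Gamma> k. Hnorm n \<Gamma> k \<sigma> ^ (2 * l)))))"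
proof (intro conjI impI)
  note C = Cconst_bounds[OF assms(1-3)]
  note bound = CBNE_Var_uses_at_most[OF assms(1-3,5,6), of l]
  have N_s: "3 * N_s n \<Gamma> l \<epsilon> \<eta> =
    3 * Cconst n \<Gamma> powr (4 * real l / 3) / (\<eta> powr (2 / 3) * \<epsilon> powr (4 / 3))"
    using powr_minus_divide[of \<eta> "2 / 3"] powr_minus_divide[of \<epsilon> "4 / 3"] by (simp add: N_s_def)
  show "is_estimate (map_pmf fst (CBNE_Var n \<Gamma> k l \<epsilon> \<eta>)) \<epsilon> \<eta>
           (1 / real (card (simplices \<Gamma> k)) *
            mat_trace (simplices \<Gamma> k) (mat_power (simplices \<Gamma> k) (Hmat n \<Gamma> k) l))"
    using assms by (rule CBNE_Var_is_estimate)
  show "uses_at_most_samples n \<Gamma> k l \<epsilon> \<eta>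
           (3 * real n powr (4 * real l / 3) / (\<eta> powr (2 / 3) * \<epsilon> powr (4 / 3)) +
            1 / (\<eta> * \<epsilon>\<^sup>2) * (1 / real (card (simplices \<Gamma> k)) *
              (\<Sum>\<sigma>\<in>simplices \<Gamma> k. Hnorm n \<Gamma> k \<sigma> ^ (2 * l))))"
    using bound unfolding N_s
  proof (rule uses_at_most_samples_mono)
    \<comment> \<open>The general bound is asserted for clique complexes as well, and follows there
      from \<open>Cconst n \<Gamma> \<le> n\<close>.\<close>
    have "Cconst n \<Gamma> powr (4 * real l / 3) \<le> real n powr (4 * real l / 3)"
      using C by (intro powr_mono2) auto
    then show "3 * Cconst n \<Gamma> powr (4 * real l / 3) / (\<eta> powr (2 / 3) * \<epsilon> powr (4 / 3)) +
        1 / (\<eta> * \<epsilon>\<^sup>2) * (1 / real (card (simplices \<Gamma> k)) *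
          (\<Sum>\<sigma>\<in>simplices \<Gamma> k. Hnorm n \<Gamma> k \<sigma> ^ (2 * l))) \<le>
      3 * real n powr (4 * real l / 3) / (\<eta> powr (2 / 3) * \<epsilon> powr (4 / 3)) +
        1 / (\<eta> * \<epsilon>\<^sup>2) * (1 / real (card (simplices \<Gamma> k)) *
          (\<Sum>\<sigma>\<in>simplices \<Gamma> k. Hnorm n \<Gamma> k \<sigma> ^ (2 * l)))"
      by (intro add_right_mono divide_right_mono) auto
  qed
  assume "is_clique_complex n \<Gamma>"
  then have "Cconst n \<Gamma> = 2" by (simp add: Cconst_def)
  then show "uses_at_most_samples n \<Gamma> k l \<epsilon> \<eta>
             (3 * 2 powr (4 * real l / 3) / (\<eta> powr (2 / 3) * \<epsilon> powr (4 / 3)) +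
              1 / (\<eta> * \<epsilon>\<^sup>2) * (1 / real (card (simplices \<Gamma> k)) *
                (\<Sum>\<sigma>\<in>simplices \<Gamma> k. Hnorm n \<Gamma> k \<sigma> ^ (2 * l))))"
    using bound N_s by simp
qed

end
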